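(* Let $X\subset\mathbb{P}^n$ be an integral and non-degenerate $m$-dimensional subvariety. Let $V\subset\mathbb{P}^n$ be a projective linear subspace such that $V\cap X=\emptyset$. Then $$R_X(V)\le n+1-m.$$
   Context: All projective spaces are over an algebraically closed field of characteristic $0$. For a non-empty linear subspace $V\subseteq\mathbb{P}^n$, the $X$-rank $R_X(V)$ is the minimal cardinality of a finite set $S\subset X$ such that $V\subseteq\langle S\rangle$, where $\langle S\rangle$ is the linear span of $S$. *)

theory Defs
  imports
    "HOL-Analysis.Analysis"
    "HOL-Library.Poly_Mapping"
begin

text \<open>
  Projective space over \<open>'k\<close> with homogeneous coordinates indexed by \<open>'n\<close>: its points are the lines
  through the origin of \<open>'k ^ 'n\<close>, so that its dimension is \<open>CARD('n) - 1\<close>.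
\<close>

typedef (overloaded) ('k :: field, 'n :: finite) proj =
  "{L :: ('k ^ 'n) set. vec.subspace L \<and> vec.dim L = 1}"
  morphisms line_of Proj
proof -
  obtain i :: 'n where True by simp
  have "axis i (1 :: 'k) \<noteq> 0"
    by (simp add: axis_eq_0_iff)
  then have "vec.dim (vec.span {axis i (1 :: 'k)}) = 1"
    using vec.dim_span_eq_card_independent[of "{axis i (1 :: 'k)}"] by simp
  then show ?thesis
    using vec.subspace_span by blast
qed

definition linear_subspace :: "('k :: field, 'n :: finite) proj set \<Rightarrow> bool" where
  "linear_subspace V \<longleftrightarrow> (\<exists>W. vec.subspace W \<and> V = {p. line_of p \<subseteq> W})"

definition linear_span :: "('k :: field, 'n :: finite) proj set \<Rightarrow> ('k, 'n) proj set" where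
  "linear_span S = linear_subspace hull S"

definition nondegenerate :: "('k :: field, 'n :: finite) proj set \<Rightarrow> bool" where
  "nondegenerate X \<longleftrightarrow> linear_span X = UNIV"


text \<open>
  Polynomials in the coordinates are finitely supported maps from exponent vectors to coefficients.
\<close>

type_synonym ('k, 'n) mpoly = "('n \<Rightarrow>\<^sub>0 nat) \<Rightarrow>\<^sub>0 'k"

definition eval_mpoly :: "('k :: field, 'n :: finite) mpoly \<Rightarrow> 'k ^ 'n \<Rightarrow> 'k" where
  "eval_mpoly f x =
     (\<Sum>a\<in>Poly_Mapping.keys f. Poly_Mapping.lookup f a * (\<Prod>i\<in>UNIV. (x $ i) ^ Poly_Mapping.lookup a i))"

definition homogeneous :: "('k :: field, 'n :: finite) mpoly \<Rightarrow> bool" where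
  "homogeneous f \<longleftrightarrow> (\<exists>d. \<forall>a\<in>Poly_Mapping.keys f. (\<Sum>i\<in>UNIV. Poly_Mapping.lookup a i) = d)"

definition zero_locus :: "('k :: field, 'n :: finite) mpoly set \<Rightarrow> ('k, 'n) proj set" where
  "zero_locus F = {p. \<forall>f\<in>F. \<forall>x\<in>line_of p. eval_mpoly f x = 0}"

definition zariski_closed :: "('k :: field, 'n :: finite) proj set \<Rightarrow> bool" where
  "zariski_closed Z \<longleftrightarrow> (\<exists>F. (\<forall>f\<in>F. homogeneous f) \<and> Z = zero_locus F)"

text \<open>
  Integral (that is, reduced and irreducible) closed subschemes over an algebraically closed field
  are identified with their sets of closed points.
\<close>

definition integral_subvariety :: "('k :: field, 'n :: finite) proj set \<Rightarrow> bool" where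
  "integral_subvariety X \<longleftrightarrow> zariski_closed X \<and> X \<noteq> {} \<and>
     (\<forall>A B. zariski_closed A \<longrightarrow> zariski_closed B \<longrightarrow> X = A \<union> B \<longrightarrow> X = A \<or> X = B)"

text \<open>
  Krull dimension of the Zariski topology.  It is meant for non-empty closed sets only: the
  supremum makes the dimension of the empty set 0.
\<close>

definition variety_dim :: "('k :: field, 'n :: finite) proj set \<Rightarrow> enat" where
  "variety_dim X = Sup {enat r | r. \<exists>Z :: nat \<Rightarrow> ('k, 'n) proj set.
     (\<forall>i\<le>r. integral_subvariety (Z i) \<and> Z i \<subseteq> X) \<and> (\<forall>i<r. Z i \<subset> Z (Suc i))}"

text \<open>
  The rank is infinite if no finite subset of \<open>X\<close> has a span containing \<open>V\<close>.
\<close>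

definition X_rank :: "('k :: field, 'n :: finite) proj set \<Rightarrow> ('k, 'n) proj set \<Rightarrow> enat" where
  "X_rank X V = (INF S \<in> {S. finite S \<and> S \<subseteq> X \<and> V \<subseteq> linear_span S}. enat (card S))"

end

theory Submission
  imports Defs "HOL-Library.Function_Algebras"
begin

text \<open>
  Let \<open>C\<close> be the affine cone over \<open>X\<close> in the vector space of dimension \<open>n + 1\<close>. Enlarge the vector space
  underlying \<open>V\<close> to a subspace \<open>W\<close> that is maximal among those meeting \<open>C\<close> in \<open>0\<close> only. By the projective
  Nullstellensatz the linear projection from \<open>W\<close> makes the coordinate ring of \<open>X\<close> finite over the ring
  of forms on its target (\<open>finiteness\<close>), and by maximality of \<open>W\<close> no nonzero form on the target vanishes on \<open>X\<close>
  (\<open>maximal_center_exists\<close>). Descending along a chain of subvarieties while enlarging the centre bounds the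
  dimension: \<open>m + 1 + dim W \<le> n + 1\<close> (\<open>chain_length_bound\<close>). It therefore suffices to find a vector
  \<open>a\<close> outside \<open>W\<close> for which \<open>M = W + ka\<close> is spanned by \<open>C \<inter> M\<close>: a basis of \<open>M\<close> inside \<open>C\<close> consists of
  \<open>dim W + 1 \<le> n + 1 - m\<close> vectors, and \<open>V\<close> lies in the span of the corresponding points of \<open>X\<close>.

  In characteristic zero the projection is generically unramified, and any \<open>a\<close> over which it is
  unramified has the required property (\<open>section_spans\<close>). Otherwise some linear form \<open>y\<close> vanishes at all points of
  \<open>X\<close> above \<open>a\<close> but not on \<open>M\<close>. Near each of these \<open>d\<close> points, the linear forms vanishing on \<open>M\<close> generate
  the ideal of the point, so \<open>y\<close> agrees to second order with one of them, say \<open>l q\<close>. The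
  product \<open>g\<close> of all \<open>y - l q\<close> has degree \<open>d\<close> but vanishes to order \<open>d + 1\<close> along \<open>C \<inter> M\<close>. Let \<open>x\<close> be a
  linear form that vanishes on \<open>W\<close> and takes the value \<open>1\<close> at \<open>a\<close>. Comparing degrees, multiplication by \<open>g\<close> and
  by \<open>x * g\<close> on the forms of a fixed large degree is given by matrices whose entries are forms in the linear forms
  vanishing on \<open>M\<close>. Both are thus algebraic over the ring of these forms, and unless \<open>g\<close> vanishes on \<open>X\<close>,
  so is \<open>x\<close>, which is impossible. Hence \<open>g\<close> vanishes on \<open>X\<close>; as \<open>X\<close> is irreducible, some \<open>y - l q\<close> does, and \<open>X\<close> is
  degenerate.
\<close>

section \<open>Functions as a ring\<close>

lemma power_fun_apply: "(f ^ k) x = (f x :: 'b :: comm_semiring_1) ^ k"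
  by (induction k) (auto simp: times_fun_apply one_fun_apply)

lemma sum_fun_apply: "sum f A x = (\<Sum>i\<in>A. (f i x :: 'b :: comm_monoid_add))"
  by (induction A rule: infinite_finite_induct) (auto simp: plus_fun_apply zero_fun_apply times_fun_apply one_fun_apply)

lemma prod_fun_apply: "prod f A x = (\<Prod>i\<in>A. (f i x :: 'b :: comm_semiring_1))"
  by (induction A rule: infinite_finite_induct) (auto simp: plus_fun_apply zero_fun_apply times_fun_apply one_fun_apply)

lemmas pointwise = plus_fun_apply zero_fun_apply times_fun_apply one_fun_apply minus_apply
  uminus_apply power_fun_apply sum_fun_apply prod_fun_apply

text \<open>
  As simplification rules these equations also rewrite unapplied functions into abstractions, after
  which rules about \<open>f + g\<close> or \<open>0\<close> no longer match. They are therefore applied on demand only.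
\<close>

declare plus_fun_apply [simp del] zero_fun_apply [simp del] times_fun_apply [simp del]
  one_fun_apply [simp del] minus_apply [simp del] uminus_apply [simp del]

section \<open>Linear forms\<close>

definition dot :: "'k :: field ^ 'n :: finite \<Rightarrow> 'k ^ 'n \<Rightarrow> 'k" where
  "dot c x = (\<Sum>i\<in>UNIV. c $ i * x $ i)"

lemma dot_simps [simp]:
  "dot c (x + y) = dot c x + dot c y" "dot c (x - y) = dot c x - dot c y"
  "dot c (a *s x) = a * dot c x" "dot c 0 = 0"
  "dot (c + d) x = dot c x + dot d x" "dot (c - d) x = dot c x - dot d x"
  "dot (a *s c) x = a * dot c x" "dot 0 x = 0"
  by (simp_all add: dot_def algebra_simps sum.distrib sum_subtractf sum_distrib_left)

lemma dot_axis [simp]: "dot (axis i 1) x = x $ i"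
proof -
  have "dot (axis i 1) x = (\<Sum>j\<in>UNIV. if j = i then x $ j else 0)"
    unfolding dot_def by (intro sum.cong) (auto simp: axis_def)
  then show ?thesis by simp
qed

lemma dot_axis_right [simp]: "dot c (axis i 1) = c $ i"
proof -
  have "dot c (axis i 1) = (\<Sum>j\<in>UNIV. if j = i then c $ j else 0)"
    unfolding dot_def by (intro sum.cong) (auto simp: axis_def)
  then show ?thesis by simp
qed

lemma dot_eq_0_iff: "(\<forall>x. dot c x = 0) \<longleftrightarrow> c = 0"
proof
  assume "\<forall>x. dot c x = 0"
  then have "c $ i = 0" for i
    using dot_axis_right[of c i] by metis
  then show "c = 0" by (simp add: vec_eq_iff)
qed simp

lemma linear_functional_eq_dot:
  fixes h :: "'k :: field ^ 'n :: finite \<Rightarrow> 'k"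
  assumes "Vector_Spaces.linear (*s) (*) h"
  obtains c where "h = dot c"
proof
  interpret h: Vector_Spaces.linear "(*s)" "(*)" h by fact
  show "h = dot (\<chi> i. h (axis i 1))"
  proof
    fix x
    have "h x = h (\<Sum>i\<in>UNIV. (x $ i) *s axis i 1)"
      by (simp add: basis_expansion)
    also have "\<dots> = dot (\<chi> i. h (axis i 1)) x"
      unfolding h.sum h.scale by (simp add: dot_def mult.commute)
    finally show "h x = dot (\<chi> i. h (axis i 1)) x" .
  qed
qed

definition annihilator :: "('k :: field ^ 'n :: finite) set \<Rightarrow> ('k ^ 'n) set" where
  "annihilator U = {c. \<forall>u\<in>U. dot c u = 0}"

lemma annihilatorD: "c \<in> annihilator U \<Longrightarrow> u \<in> U \<Longrightarrow> dot c u = 0"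
  by (simp add: annihilator_def)

lemma annihilator_closed [simp]:
  "0 \<in> annihilator U"
  "c \<in> annihilator U \<Longrightarrow> d \<in> annihilator U \<Longrightarrow> c + d \<in> annihilator U"
  "c \<in> annihilator U \<Longrightarrow> d \<in> annihilator U \<Longrightarrow> c - d \<in> annihilator U"
  "c \<in> annihilator U \<Longrightarrow> a *s c \<in> annihilator U"
  "c \<in> annihilator {0}"
  by (auto simp: annihilator_def)

text \<open>
  A basis of \<open>U\<close> together with \<open>v\<close> is independent, so the values \<open>0\<close> on the basis and \<open>1\<close> at \<open>v\<close> extend
  to a linear functional.
\<close>

lemma separating_functional:
  fixes U :: "('k :: field ^ 'n :: finite) set"
  assumes "vec.subspace U" and "v \<notin> U"
  obtains c where "c \<in> annihilator U" and "dot c v = 1"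
proof -
  interpret vp: vector_space_pair "(*s) :: 'k \<Rightarrow> 'k ^ 'n \<Rightarrow> _" "(*) :: 'k \<Rightarrow> 'k \<Rightarrow> 'k"
    by unfold_locales
  obtain B where B: "B \<subseteq> U" "vec.independent B" "U \<subseteq> vec.span B"
    using vec.maximal_independent_subset by metis
  have span: "vec.span B = U"
    using B assms(1) vec.span_minimal by blast
  have ind: "vec.independent (insert v B)"
    using B assms(2) span by (simp add: vec.independent_insertI)
  obtain h where h: "Vector_Spaces.linear (*s) (*) h" "\<forall>x\<in>insert v B. h x = (if x = v then 1 else 0)"
    using vp.linear_independent_extend[OF ind, of "\<lambda>x. if x = v then 1 else 0"] by blast
  obtain c where c: "h = dot c"
    using linear_functional_eq_dot[OF h(1)] .
  have "dot c u = 0" if "u \<in> U" for u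
  proof (rule vp.linear_eq_0_on_span[of h B u, unfolded c])
    show "Vector_Spaces.linear (*s) (*) (dot c)" using h(1) c by simp
    show "u \<in> vec.span B" using that span by simp
    show "dot c b = 0" if "b \<in> B" for b
      using h(2) c that assms(2) B(1) by auto
  qed
  then show thesis
    using that h(2) c by (auto simp: annihilator_def)
qed

lemma annihilator_antimono: "U \<subseteq> U' \<Longrightarrow> annihilator U' \<subseteq> annihilator U"
  by (auto simp: annihilator_def)

section \<open>Forms in the linear forms vanishing on a subspace\<close>

text \<open>
  The forms of degree \<open>d\<close> on the quotient of the ambient space by \<open>U\<close>, seen as functions on the ambient
  space. For \<open>U = {0}\<close> these are all forms; in general they are the coordinate ring of the target of the
  linear projection from \<open>U\<close>. The base field is infinite in all applications, so that nothing is lost in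
  replacing polynomials by functions. The zero function counts as a form of every degree.
\<close>

inductive form :: "('k :: field ^ 'n :: finite) set \<Rightarrow> nat \<Rightarrow> ('k ^ 'n \<Rightarrow> 'k) \<Rightarrow> bool" for U where
  form_zero: "form U d 0"
| form_const: "form U 0 (\<lambda>_. c)"
| form_add: "form U d f \<Longrightarrow> form U d g \<Longrightarrow> form U d (f + g)"
| form_dot: "c \<in> annihilator U \<Longrightarrow> form U d f \<Longrightarrow> form U (Suc d) (dot c * f)"

lemma form_one: "form U 0 1"
  using form_const[of U 1] by (simp add: one_fun_def)

lemma form_mult: "form U d f \<Longrightarrow> form U e g \<Longrightarrow> form U (d + e) (f * g)"
proof (induction rule: form.induct)
  case (form_const c)
  have "form U e ((\<lambda>_. c) * g)" using form_const
  proof (induction rule: form.induct)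
    case (form_const c')
    then show ?case using form.form_const[of U "c * c'"] by (simp add: times_fun_def)
  next
    case (form_dot c' d f)
    then show ?case using form.form_dot[of c' U d "(\<lambda>_. c) * f"] by (metis mult.left_commute)
  qed (auto simp: distrib_left intro: form.intros)
  then show ?case by simp
qed (auto simp: distrib_right mult.assoc intro: form.intros)

lemma form_scale: "form U d f \<Longrightarrow> form U d ((\<lambda>_. c) * f)"
  using form_mult[OF form_const[of U c]] by simp

lemma form_diff: "form U d f \<Longrightarrow> form U d g \<Longrightarrow> form U d (f - g)"
proof -
  assume "form U d f" "form U d g"
  then have "form U d (f + (\<lambda>_. -1) * g)"
    by (intro form_add form_scale)
  moreover have "f + (\<lambda>_. -1) * g = f - g" by (auto simp: fun_eq_iff pointwise)
  ultimately show ?thesis by simp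
qed

lemma form_linear: "c \<in> annihilator U \<Longrightarrow> form U 1 (dot c)"
  using form_dot[OF _ form_one] by (metis One_nat_def mult.right_neutral)

lemma form_power: "form U d f \<Longrightarrow> form U (d * k) (f ^ k)"
  by (induction k) (auto intro: form_one form_mult)

lemma form_sum: "(\<And>i. i \<in> A \<Longrightarrow> form U d (f i)) \<Longrightarrow> form U d (sum f A)"
  by (induction A rule: infinite_finite_induct) (auto intro: form_zero form_add)

lemma form_prod: "finite A \<Longrightarrow> (\<And>i. i \<in> A \<Longrightarrow> form U (d i) (f i)) \<Longrightarrow> form U (sum d A) (prod f A)"
  by (induction A rule: finite_induct) (auto intro: form_one form_mult)

lemma form_antimono: "form U' d f \<Longrightarrow> U \<subseteq> U' \<Longrightarrow> form U d f"
  by (induction rule: form.induct) (use annihilator_antimono in \<open>blast intro: form.intros\<close>)+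

lemma form_weaken: "form U d f \<Longrightarrow> form {0} d f"
  by (induction rule: form.induct) (use annihilator_closed(5) in \<open>blast intro: form.intros\<close>)+

lemma form_homogeneous: "form U d f \<Longrightarrow> f (a *s x) = a ^ d * f x"
  by (induction rule: form.induct) (auto simp: algebra_simps pointwise)

lemma form_invariant: "form U d f \<Longrightarrow> u \<in> U \<Longrightarrow> f (x + u) = f x"
  by (induction rule: form.induct) (auto simp: annihilatorD pointwise)

lemma form_degree_0:
  assumes "form U 0 f" obtains c where "f = (\<lambda>_. c)"
proof -
  have "\<exists>c. f = (\<lambda>_. c)" if "form U d f" "d = 0" for d
    using that
  proof (induction rule: form.induct)
    case (form_zero d)
    then show ?case by (auto simp: zero_fun_def)
  qed (auto simp: plus_fun_def)
  then show thesis using assms that by blast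
qed

lemma form_degree_1:
  assumes "form U 1 f" obtains c where "c \<in> annihilator U" "f = dot c"
proof -
  have "\<exists>c\<in>annihilator U. f = dot c" if "form U d f" "d = 1" for d
    using that
  proof (induction rule: form.induct)
    case (form_zero d)
    then show ?case by (intro bexI[of _ 0]) (auto simp: fun_eq_iff pointwise)
  next
    case (form_add d f g)
    then obtain c c' where "c \<in> annihilator U" "c' \<in> annihilator U" "f = dot c" "g = dot c'" by auto
    then show ?case by (intro bexI[of _ "c + c'"]) (auto simp: fun_eq_iff pointwise)
  next
    case (form_dot c d f)
    then obtain b where "f = (\<lambda>_. b)" using form_degree_0 by auto
    then show ?case using form_dot by (intro bexI[of _ "b *s c"]) (auto simp: fun_eq_iff pointwise)
  qed auto
  then show thesis using assms that by blast
qed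

lemma form_along_line: "form U d f \<Longrightarrow> \<exists>p. \<forall>t. f (u + t *s v) = poly p t"
proof (induction rule: form.induct)
  case (form_zero d)
  show ?case by (intro exI[of _ 0]) (auto simp: pointwise)
next
  case (form_const c)
  show ?case by (intro exI[of _ "[:c:]"]) auto
next
  case (form_add d f g)
  then obtain p q where "\<forall>t. f (u + t *s v) = poly p t" "\<forall>t. g (u + t *s v) = poly q t" by auto
  then show ?case by (intro exI[of _ "p + q"]) (auto simp: pointwise)
next
  case (form_dot c d f)
  then obtain p where "\<forall>t. f (u + t *s v) = poly p t" by auto
  then show ?case by (intro exI[of _ "[:dot c u, dot c v:] * p"]) (auto simp: pointwise algebra_simps)
qed

text \<open>
  Restrict both forms to a line that joins a point where the first does not vanish to one where the
  second does not vanish: there they are nonzero polynomials in one variable.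
\<close>

lemma form_no_zero_divisors:
  fixes f g :: "'k :: field_char_0 ^ 'n :: finite \<Rightarrow> 'k"
  assumes "form U d f" "form U e g" "f * g = 0"
  shows "f = 0 \<or> g = 0"
proof (rule ccontr)
  assume "\<not> (f = 0 \<or> g = 0)"
  then obtain u v where uv: "f u \<noteq> 0" "g v \<noteq> 0"
    by (auto simp: fun_eq_iff pointwise)
  obtain p q where p: "\<And>t. f (u + t *s (v - u)) = poly p t"
    and q: "\<And>t. g (u + t *s (v - u)) = poly q t"
    using form_along_line[OF assms(1)] form_along_line[OF assms(2)] by metis
  have "poly (p * q) t = 0" for t
    using assms(3) p q by (metis poly_mult times_fun_apply zero_fun_apply)
  then have "p * q = 0"
    using poly_all_0_iff_0 by blast
  moreover have "p \<noteq> 0" using p[of 0] uv by auto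
  moreover have "q \<noteq> 0" using q[of 1] uv by auto
  ultimately show False by simp
qed

lemma form_finitely_generated:
  "\<exists>B. finite B \<and> (\<forall>b\<in>B. form U d b) \<and> (\<forall>f. form U d f \<longrightarrow> (\<exists>c. f = (\<Sum>b\<in>B. (\<lambda>_. c b) * b)))"
proof (induction d)
  case 0
  have "\<exists>c. f = (\<Sum>b\<in>{1}. (\<lambda>_. c b) * b)" if f: "form U 0 f" for f
  proof -
    obtain a where "f = (\<lambda>_. a)" using form_degree_0[OF f] .
    then show ?thesis by (intro exI[of _ "\<lambda>_. a"]) (simp add: fun_eq_iff pointwise)
  qed
  then show ?case
    using form_one by (intro exI[of _ "{1}"]) blast
next
  case (Suc d)
  then obtain B where B: "finite B" "\<forall>b\<in>B. form U d b"
    "\<forall>f. form U d f \<longrightarrow> (\<exists>c. f = (\<Sum>b\<in>B. (\<lambda>_. c b) * b))"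
    by (elim exE conjE)
  have subsp: "vec.subspace (annihilator U)"
    by (auto simp: vec.subspace_def)
  obtain L where L: "L \<subseteq> annihilator U" "vec.independent L" "annihilator U \<subseteq> vec.span L"
    using vec.maximal_independent_subset by metis
  then have finL: "finite L" by (simp add: vec.finiteI_independent)
  define B' where "B' = (\<lambda>(l, b). dot l * b) ` (L \<times> B)"
  have fin: "finite B'" unfolding B'_def using finL B(1) by auto
  define comb where "comb c = (\<Sum>b\<in>B'. (\<lambda>_. c b) * b)" for c
  let ?S = "range comb"
  have comb: "comb c x = (\<Sum>b\<in>B'. c b * b x)" for c x
    by (simp add: comb_def pointwise)
  have S_base: "b \<in> ?S" if "b \<in> B'" for b
  proof
    show "b = comb (\<lambda>b'. if b' = b then 1 else 0)"
    proof
      fix x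
      have "comb (\<lambda>b'. if b' = b then 1 else 0) x = (\<Sum>b'\<in>B'. if b' = b then b' x else 0)"
        unfolding comb by (auto intro: sum.cong)
      then show "b x = comb (\<lambda>b'. if b' = b then 1 else 0) x"
        using that fin by simp
    qed
  qed simp
  have S_add: "f + g \<in> ?S" if fg: "f \<in> ?S" "g \<in> ?S" for f g
  proof -
    obtain c c' where "f = comb c" "g = comb c'" using fg by auto
    then have "f + g = comb (\<lambda>b. c b + c' b)"
      by (simp add: comb sum.distrib[symmetric] fun_eq_iff pointwise algebra_simps)
    then show ?thesis by simp
  qed
  have S_scale: "(\<lambda>_. a) * f \<in> ?S" if f: "f \<in> ?S" for a f
  proof -
    obtain c where "f = comb c" using f by auto
    then have "(\<lambda>_. a) * f = comb (\<lambda>b. a * c b)"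
      by (simp add: comb fun_eq_iff pointwise sum_distrib_left mult.assoc)
    then show ?thesis by simp
  qed
  have S_zero: "0 \<in> ?S"
  proof
    show "0 = comb (\<lambda>_. 0)" by (simp add: comb fun_eq_iff pointwise)
  qed simp
  have S_sum: "sum f A \<in> ?S" if "\<And>i. i \<in> A \<Longrightarrow> f i \<in> ?S" for A :: "'z set" and f
    using that by (induction A rule: infinite_finite_induct) (use S_zero S_add in auto)
  have S_dot: "dot l * f \<in> ?S" if l: "l \<in> annihilator U" and f: "form U d f" for l f
  proof -
    obtain a where a: "l = (\<Sum>x\<in>L. a x *s x)"
      using l L(3) vec.span_finite[OF finL] by auto
    obtain c where c: "f = (\<Sum>b\<in>B. (\<lambda>_. c b) * b)"
      using B(3) f by (elim allE impE exE)
    have dsum: "dot (\<Sum>x\<in>A. a x *s x) y = (\<Sum>x\<in>A. a x * dot x y)" for A y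
      by (induction A rule: infinite_finite_induct) auto
    have "dot l * f = (\<Sum>x\<in>L. \<Sum>b\<in>B. (\<lambda>_. a x * c b) * (dot x * b))"
    proof
      fix y
      have "(dot l * f) y = (\<Sum>x\<in>L. a x * dot x y) * (\<Sum>b\<in>B. c b * b y)"
        by (simp add: a c dsum pointwise)
      also have "\<dots> = (\<Sum>x\<in>L. \<Sum>b\<in>B. (a x * dot x y) * (c b * b y))"
        by (rule sum_product)
      finally show "(dot l * f) y = (\<Sum>x\<in>L. \<Sum>b\<in>B. (\<lambda>_. a x * c b) * (dot x * b)) y"
        by (simp add: mult_ac pointwise)
    qed
    also have "\<dots> \<in> ?S"
      by (intro S_sum S_scale S_base) (auto simp: B'_def)
    finally show ?thesis .
  qed
  have "f \<in> ?S" if "form U e f" "e = Suc d" for e f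
    using that by (induction rule: form.induct) (use S_zero S_add S_dot in auto)
  then have gen: "\<forall>f. form U (Suc d) f \<longrightarrow> (\<exists>c. f = (\<Sum>b\<in>B'. (\<lambda>_. c b) * b))"
    unfolding comb_def by blast
  have "form U (Suc d) b" if "b \<in> B'" for b
    using that B(2) L(1) by (auto simp: B'_def intro: form_dot)
  then show ?case using fin gen by blast
qed

section \<open>Powers of the ideal of a subspace\<close>

text \<open>
  \<open>ideal_power C U e d f\<close> says that on \<open>C\<close> the function \<open>f\<close> agrees with a form of degree \<open>d\<close> in the
  \<open>e\<close>-th power of the ideal generated by the linear forms vanishing on \<open>U\<close>. Indexing by the total degree
  \<open>d\<close>, rather than by the degree of the cofactors, keeps the notion meaningful for \<open>d < e\<close>, where
  only functions vanishing on \<open>C\<close> are left.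
\<close>

inductive ideal_power :: "('k :: field ^ 'n :: finite) set \<Rightarrow> ('k ^ 'n) set \<Rightarrow> nat \<Rightarrow> nat \<Rightarrow> ('k ^ 'n \<Rightarrow> 'k) \<Rightarrow> bool"
  for C U e d where
  ideal_power_zero: "(\<And>x. x \<in> C \<Longrightarrow> f x = 0) \<Longrightarrow> ideal_power C U e d f"
| ideal_power_step: "ideal_power C U e d h \<Longrightarrow> form U e g \<Longrightarrow> form {0} n s \<Longrightarrow> e + n = d \<Longrightarrow>
    (\<And>x. x \<in> C \<Longrightarrow> f x = g x * s x + h x) \<Longrightarrow> ideal_power C U e d f"

lemma ideal_power_cong:
  assumes "ideal_power C U e d f" "\<And>x. x \<in> C \<Longrightarrow> f x = f' x"
  shows "ideal_power C U e d f'"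
  using assms by (cases rule: ideal_power.cases) (auto intro: ideal_power.intros)

lemma ideal_power_product:
  assumes "form U e g" "form {0} n s" "e + n = d"
  shows "ideal_power C U e d (g * s)"
  by (rule ideal_power_step[OF ideal_power_zero[of C 0] assms]) (auto simp: pointwise)

lemma ideal_power_add:
  assumes "ideal_power C U e d f" "ideal_power C U e d f'"
  shows "ideal_power C U e d (f + f')"
  using assms
proof (induction rule: ideal_power.induct)
  case (ideal_power_zero f)
  then show ?case by (auto intro: ideal_power_cong simp: pointwise)
next
  case (ideal_power_step h g n s f)
  show ?case
    by (rule ideal_power.ideal_power_step[OF ideal_power_step.IH[OF ideal_power_step.prems]
      ideal_power_step.hyps(2-4)]) (simp add: ideal_power_step.hyps pointwise)
qed

lemma ideal_power_mult:
  assumes "ideal_power C U e d f" "form U e' g'" "form {0} n' s'"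
  shows "ideal_power C U (e + e') (d + e' + n') (g' * s' * f)"
  using assms(1)
proof (induction rule: ideal_power.induct)
  case (ideal_power_zero f)
  then show ?case by (auto intro!: ideal_power.ideal_power_zero simp: pointwise)
next
  case (ideal_power_step h g n s f)
  show ?case
  proof (rule ideal_power.ideal_power_step[OF ideal_power_step.IH
      form_mult[OF ideal_power_step.hyps(2) assms(2)] form_mult[OF ideal_power_step.hyps(3) assms(3)]])
    show "e + e' + (n + n') = d + e' + n'" using ideal_power_step.hyps(4) by simp
    show "(g' * s' * f) x = (g * g') x * (s * s') x + (g' * s' * h) x" if "x \<in> C" for x
      unfolding times_fun_apply ideal_power_step.hyps(5)[OF that] by (simp add: algebra_simps)
  qed
qed

lemma ideal_power_mult_form:
  "ideal_power C U e d f \<Longrightarrow> form {0} n s \<Longrightarrow> ideal_power C U e (d + n) (s * f)"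
  using ideal_power_mult[OF _ form_one] by force

lemma ideal_power_mult_order:
  "ideal_power C U e d f \<Longrightarrow> form U e' g \<Longrightarrow> ideal_power C U (e + e') (d + e') (g * f)"
  using ideal_power_mult[OF _ _ form_one] by force

lemma ideal_power_sum:
  "(\<And>i. i \<in> A \<Longrightarrow> ideal_power C U e d (f i)) \<Longrightarrow> ideal_power C U e d (sum f A)"
  by (induction A rule: infinite_finite_induct) (auto intro: ideal_power_add ideal_power_zero simp: pointwise)

lemma ideal_power_times:
  assumes "ideal_power C U e d f" "ideal_power C U e' d' f'"
  shows "ideal_power C U (e + e') (d + d') (f * f')"
  using assms(2)
proof (induction rule: ideal_power.induct)
  case (ideal_power_zero f')
  then show ?case by (auto intro!: ideal_power.ideal_power_zero simp: pointwise)
next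
  case (ideal_power_step h g n s f')
  have "ideal_power C U (e + e') (d + e' + n) (g * s * f)"
    using ideal_power_mult[OF assms(1)] ideal_power_step.hyps by auto
  then have "ideal_power C U (e + e') (d + d') (g * s * f + f * h)"
    using ideal_power_step.hyps(4) ideal_power_step.IH by (intro ideal_power_add) (auto simp: add.assoc mult_ac)
  then show ?case
    by (rule ideal_power_cong) (auto simp: ideal_power_step.hyps(5) algebra_simps pointwise)
qed

lemma form_imp_ideal_power:
  assumes "form U d g" "e \<le> d"
  shows "ideal_power C U e d g"
  using assms
proof (induction rule: form.induct)
  case (form_zero d)
  then show ?case by (auto intro: ideal_power_zero simp: pointwise)
next
  case (form_const c)
  then show ?case
    using ideal_power_product[OF form.form_const[of U c] form_one, of 0] by simp
next
  case (form_add d f g)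
  then show ?case by (auto intro: ideal_power_add)
next
  case (form_dot c d f)
  show ?case
  proof (cases "e \<le> d")
    case True
    with form_dot show ?thesis
      using ideal_power_mult_form[of C U e d f 1 "dot c"] form_linear[OF form_dot(1)]
      by (auto intro: form_weaken)
  next
    case False
    then have "e = Suc d" using form_dot by simp
    moreover have "ideal_power C U (Suc d) (Suc d) (dot c * f * 1)"
      by (intro ideal_power_product[OF form.form_dot[OF form_dot(1,2)] form_one]) simp
    ultimately show ?thesis by simp
  qed
qed

lemma ideal_power_lower:
  assumes "ideal_power C U e' d f" "e \<le> e'"
  shows "ideal_power C U e d f"
  using assms
proof (induction rule: ideal_power.induct)
  case (ideal_power_zero f)
  then show ?case by (auto intro!: ideal_power.ideal_power_zero simp: pointwise)
next
  case (ideal_power_step h g n s f)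
  have "ideal_power C U e (e' + n) (s * g)"
    using form_imp_ideal_power[OF ideal_power_step.hyps(2) \<open>e \<le> e'\<close>] ideal_power_step.hyps(3)
    by (rule ideal_power_mult_form)
  then have "ideal_power C U e d (s * g + h)"
    using ideal_power_step by (auto intro: ideal_power_add)
  then show ?case
    by (rule ideal_power_cong) (auto simp: ideal_power_step.hyps(5) algebra_simps pointwise)
qed

section \<open>Linear dependence over a graded domain\<close>

text \<open>
  More vectors than coordinates are linearly dependent, also over a graded domain, and the coefficients
  of the relation can be chosen homogeneous. The induction removes one coordinate by fraction-free Gaussian
  elimination: a vector \<open>v k\<close> with nonzero entry \<open>u\<close> in that coordinate is used to replace each
  other \<open>v i\<close> by \<open>u * v i - v i l * v k\<close>, which raises its degree by that of \<open>v k\<close>.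
  The degree condition is imposed on nonzero coefficients only, since \<open>deg i\<close> may exceed the common degree
  \<open>E\<close> of the terms when the coefficient vanishes.
\<close>

lemma homogeneous_dependence:
  fixes G :: "nat \<Rightarrow> 'r :: comm_ring_1 set" and v :: "'i \<Rightarrow> 'j \<Rightarrow> 'r"
  assumes G: "\<And>d. 0 \<in> G d" "1 \<in> G 0" "\<And>d a b. a \<in> G d \<Longrightarrow> b \<in> G d \<Longrightarrow> a - b \<in> G d"
      "\<And>d e a b. a \<in> G d \<Longrightarrow> b \<in> G e \<Longrightarrow> a * b \<in> G (d + e)"
      "\<And>d e a b. a \<in> G d \<Longrightarrow> b \<in> G e \<Longrightarrow> a * b = 0 \<Longrightarrow> a = 0 \<or> b = 0"
    and "finite J" "finite I" "card J < card I"
    and "\<And>i j. i \<in> I \<Longrightarrow> j \<in> J \<Longrightarrow> v i j \<in> G (deg i)"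
  shows "\<exists>p E. (\<forall>i\<in>I. p i \<noteq> 0 \<longrightarrow> (\<exists>q. p i \<in> G q \<and> q + deg i = E)) \<and> (\<exists>i\<in>I. p i \<noteq> 0) \<and>
           (\<forall>j\<in>J. (\<Sum>i\<in>I. p i * v i j) = 0)"
  using assms(6-)
proof (induction J arbitrary: I v deg rule: finite_induct)
  case empty
  then obtain i where i: "i \<in> I" by fastforce
  show ?case
    by (intro exI[of _ "\<lambda>i'. if i' = i then 1 else 0"] exI[of _ "deg i"])
       (use i G(2) in \<open>auto intro!: exI[of _ 0]\<close>)
next
  case (insert l J)
  show ?case
  proof (cases "\<forall>i\<in>I. v i l = 0")
    case True
    have card: "card J < card I" using insert by simp
    have "v i j \<in> G (deg i)" if "i \<in> I" "j \<in> J" for i j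
      using insert.prems that by simp
    then have "\<exists>p E. (\<forall>i\<in>I. p i \<noteq> 0 \<longrightarrow> (\<exists>q. p i \<in> G q \<and> q + deg i = E)) \<and> (\<exists>i\<in>I. p i \<noteq> 0) \<and>
           (\<forall>j\<in>J. (\<Sum>i\<in>I. p i * v i j) = 0)"
      by (rule insert.IH[OF insert.prems(1) card])
    then obtain p E where
      "\<forall>i\<in>I. p i \<noteq> 0 \<longrightarrow> (\<exists>q. p i \<in> G q \<and> q + deg i = E)" "\<exists>i\<in>I. p i \<noteq> 0"
      "\<forall>j\<in>J. (\<Sum>i\<in>I. p i * v i j) = 0"
      by (elim exE conjE)
    then show ?thesis using True
      by (intro exI[of _ p] exI[of _ E]) auto
  next
    case False
    then obtain k where k: "k \<in> I" "v k l \<noteq> 0" by auto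
    define u where "u = v k l"
    define I' where "I' = I - {k}"
    define v' where "v' i j = u * v i j - v i l * v k j" for i j
    have fin: "finite I'" and card: "card J < card I'"
      using insert k by (auto simp: I'_def)
    have vG: "v i j \<in> G (deg i)" if "i \<in> I" "j \<in> insert l J" for i j
      using insert.prems that by auto
    have "v' i j \<in> G (deg i + deg k)" if "i \<in> I'" "j \<in> J" for i j
    proof -
      have "u * v i j \<in> G (deg k + deg i)" "v i l * v k j \<in> G (deg i + deg k)"
        unfolding u_def using that k by (intro G(4) vG; auto simp: I'_def)+
      then show ?thesis unfolding v'_def using G(3) by (simp add: add.commute)
    qed
    then have "\<exists>p E. (\<forall>i\<in>I'. p i \<noteq> 0 \<longrightarrow> (\<exists>q. p i \<in> G q \<and> q + (deg i + deg k) = E)) \<and>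
           (\<exists>i\<in>I'. p i \<noteq> 0) \<and> (\<forall>j\<in>J. (\<Sum>i\<in>I'. p i * v' i j) = 0)"
      by (rule insert.IH[OF fin card])
    then obtain p E where
      p: "\<forall>i\<in>I'. p i \<noteq> 0 \<longrightarrow> (\<exists>q. p i \<in> G q \<and> q + (deg i + deg k) = E)"
        "\<exists>i\<in>I'. p i \<noteq> 0" and dep: "\<forall>j\<in>J. (\<Sum>i\<in>I'. p i * v' i j) = 0"
      by (elim exE conjE)
    \<comment> \<open>The coefficient of the pivot is forced by the eliminated coordinate.\<close>
    define p' where "p' i = (if i = k then - (\<Sum>i\<in>I'. p i * v i l) else p i * u)" for i
    have neg: "- a \<in> G d" if "a \<in> G d" for a d
      using G(3)[OF G(1) that] by simp
    have G_sum: "sum f A \<in> G d" if "\<And>i. i \<in> A \<Longrightarrow> f i \<in> G d" for f and A :: "'i set" and d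
      using that
    proof (induction A rule: infinite_finite_induct)
      case (insert i A)
      then have "f i - (- sum f A) \<in> G d" by (intro G(3) neg) auto
      then show ?case using insert by simp
    qed (auto intro: G(1))
    have uG: "u \<in> G (deg k)" using vG k by (auto simp: u_def)
    have deg: "\<exists>q. p' i \<in> G q \<and> q + deg i = E" if i: "i \<in> I" "p' i \<noteq> 0" for i
    proof (cases "i = k")
      case False
      then have "p i \<noteq> 0" "i \<in> I'" using i by (auto simp: p'_def I'_def)
      then obtain q where "p i \<in> G q" "q + (deg i + deg k) = E" using p(1) by blast
      then show ?thesis using False G(4)[OF _ uG]
        by (intro exI[of _ "q + deg k"]) (auto simp: p'_def)
    next
      case True
      have t: "p i * v i l \<in> G (E - deg k)" "deg k \<le> E \<or> p i = 0" if "i \<in> I'" for i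
      proof -
        have "p i * v i l \<in> G (E - deg k) \<and> (deg k \<le> E \<or> p i = 0)"
        proof (cases "p i = 0")
          case False
          then obtain q where "p i \<in> G q" "q + (deg i + deg k) = E" using p(1) \<open>i \<in> I'\<close> by blast
          moreover from this have "q + deg i = E - deg k" by simp
          moreover have "v i l \<in> G (deg i)" using vG that by (auto simp: I'_def)
          ultimately show ?thesis using G(4) by (metis add_leE add.commute le_add2)
        qed (simp add: G(1))
        then show "p i * v i l \<in> G (E - deg k)" "deg k \<le> E \<or> p i = 0" by auto
      qed
      have "deg k \<le> E" using t(2) p(2) by auto
      moreover have "p' i \<in> G (E - deg k)"
        unfolding p'_def using True by (auto intro: neg G_sum t(1))
      ultimately show ?thesis using True by auto
    qed
    have nz: "\<exists>i\<in>I. p' i \<noteq> 0"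
    proof -
      obtain i where i: "i \<in> I'" "p i \<noteq> 0" using p(2) by auto
      then obtain q where "p i \<in> G q" using p(1) by blast
      then have "p i * u \<noteq> 0" using G(5)[OF _ uG] i k by (auto simp: u_def)
      then show ?thesis using i by (auto simp: p'_def I'_def)
    qed
    have "(\<Sum>i\<in>I. p' i * v i j) = 0" if j: "j \<in> insert l J" for j
    proof -
      have "(\<Sum>i\<in>I. p' i * v i j) = p' k * v k j + (\<Sum>i\<in>I'. p' i * v i j)"
        unfolding I'_def using k insert.prems by (simp add: sum.remove)
      also have "(\<Sum>i\<in>I'. p' i * v i j) = (\<Sum>i\<in>I'. p i * u * v i j)"
        by (intro sum.cong) (auto simp: p'_def I'_def)
      also have "p' k * v k j + \<dots> = (\<Sum>i\<in>I'. p i * (u * v i j - v i l * v k j))"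
        by (simp add: p'_def sum_distrib_left sum_distrib_right right_diff_distrib sum_subtractf mult_ac)
      also have "\<dots> = 0"
        using j dep by (cases "j = l") (auto simp: u_def v'_def)
      finally show ?thesis .
    qed
    then show ?thesis using deg nz by blast
  qed
qed

section \<open>The projective Nullstellensatz\<close>

text \<open>
  An ideal is a set of forms tagged with their degrees, because the zero function has every degree.
\<close>

definition graded_ideal :: "(nat \<times> ('k :: field ^ 'n :: finite \<Rightarrow> 'k)) set \<Rightarrow> bool" where
  "graded_ideal J \<longleftrightarrow> (\<forall>d. (d, 0) \<in> J) \<and> (\<forall>d f. (d, f) \<in> J \<longrightarrow> form {0} d f) \<and>
     (\<forall>d f g. (d, f) \<in> J \<longrightarrow> (d, g) \<in> J \<longrightarrow> (d, f + g) \<in> J) \<and>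
     (\<forall>d e f s. (d, f) \<in> J \<longrightarrow> form {0} e s \<longrightarrow> (d + e, s * f) \<in> J)"

text \<open>
  Containing no power of the irrelevant ideal: once an ideal contains all forms of one degree, it contains
  all forms of every larger degree.
\<close>

definition relevant :: "(nat \<times> ('k :: field ^ 'n :: finite \<Rightarrow> 'k)) set \<Rightarrow> bool" where
  "relevant J \<longleftrightarrow> (\<forall>d. \<exists>f. form {0} d f \<and> (d, f) \<notin> J)"

lemma graded_idealD:
  assumes "graded_ideal J"
  shows "(d, 0) \<in> J" "(d, f) \<in> J \<Longrightarrow> form {0} d f" "(d, f) \<in> J \<Longrightarrow> (d, g) \<in> J \<Longrightarrow> (d, f + g) \<in> J"
    "(d, f) \<in> J \<Longrightarrow> form {0} e s \<Longrightarrow> (d + e, s * f) \<in> J"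
  using assms unfolding graded_ideal_def by blast+

lemma graded_ideal_scale:
  "graded_ideal J \<Longrightarrow> (d, f) \<in> J \<Longrightarrow> (d, (\<lambda>_. c) * f) \<in> J"
  using graded_idealD(4)[of J d f 0, OF _ _ form_const] by force

lemma graded_ideal_diff:
  assumes J: "graded_ideal J" and "(d, f) \<in> J" "(d, g) \<in> J"
  shows "(d, f - g) \<in> J"
proof -
  have "f - g = f + (\<lambda>_. -1) * g" by (auto simp: fun_eq_iff pointwise)
  then show ?thesis
    using graded_idealD(3)[OF J assms(2) graded_ideal_scale[OF J assms(3)]] by metis
qed

lemma graded_ideal_sum:
  "graded_ideal J \<Longrightarrow> (\<And>i. i \<in> A \<Longrightarrow> (d, f i) \<in> J) \<Longrightarrow> (d, sum f A) \<in> J"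
  by (induction A rule: infinite_finite_induct) (auto intro: graded_idealD)

text \<open>
  Membership of all forms of a given degree can be tested on products, because forms of degree \<open>d + e\<close>
  are sums of products of forms of degrees \<open>d\<close> and \<open>e\<close>.
\<close>

lemma graded_ideal_products:
  assumes J: "graded_ideal J" and f: "form {0} (d + e) f"
    and prod: "\<And>g s. form {0} d g \<Longrightarrow> form {0} e s \<Longrightarrow> (d + e, g * s) \<in> J"
  shows "(d + e, f) \<in> J"
proof -
  have "ideal_power UNIV {0} d (d + e) f"
    by (rule form_imp_ideal_power[OF f]) simp
  then show ?thesis
  proof (induction rule: ideal_power.induct)
    case (ideal_power_zero f)
    then have "f = 0" by (auto simp: fun_eq_iff pointwise)
    then show ?case using graded_idealD(1)[OF J] by simp
  next
    case (ideal_power_step h g n s f)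
    then have "f = g * s + h" by (auto simp: fun_eq_iff pointwise)
    moreover have "(d + e, g * s) \<in> J" using prod[of g s] ideal_power_step.hyps by simp
    ultimately show ?case
      using graded_idealD(3)[OF J _ ideal_power_step.IH] by simp
  qed
qed

text \<open>
  Zorn's lemma applies because the forms of a fixed degree are spanned by finitely many: if the union of
  a chain contained all of them, so would a member of the chain.
\<close>

lemma relevant_maximal_exists:
  fixes J :: "(nat \<times> ('k :: field ^ 'n :: finite \<Rightarrow> 'k)) set"
  assumes "graded_ideal J" "relevant J"
  obtains M where "J \<subseteq> M" "graded_ideal M" "relevant M"
    "\<And>M'. M \<subseteq> M' \<Longrightarrow> graded_ideal M' \<Longrightarrow> relevant M' \<Longrightarrow> M' = M"
proof -
  let ?A = "{M. J \<subseteq> M \<and> graded_ideal M \<and> relevant M}"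
  have "\<Union>\<C> \<in> ?A" if ne: "\<C> \<noteq> {}" and ch: "subset.chain ?A \<C>" for \<C>
  proof -
    have sub: "\<C> \<subseteq> ?A" and lin: "\<And>M M'. M \<in> \<C> \<Longrightarrow> M' \<in> \<C> \<Longrightarrow> M \<subseteq> M' \<or> M' \<subseteq> M"
      using ch by (auto simp: subset_chain_def)
    have fin: "\<exists>M\<in>\<C>. S \<subseteq> M" if "finite S" "S \<subseteq> \<Union>\<C>" for S
      using that
    proof (induction S rule: finite_induct)
      case (insert x S)
      then obtain M where M: "M \<in> \<C>" "S \<subseteq> M" by auto
      obtain M' where M': "M' \<in> \<C>" "x \<in> M'" using insert.prems by auto
      show ?case
        using lin[OF M(1) M'(1)]
      proof
        assume "M \<subseteq> M'"
        then show ?thesis using M M' by (intro bexI[of _ M']) auto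
      next
        assume "M' \<subseteq> M"
        then show ?thesis using M M' by (intro bexI[of _ M]) auto
      qed
    qed (use ne in auto)
    have two: "\<exists>M\<in>\<C>. x \<in> M \<and> y \<in> M" if "x \<in> \<Union>\<C>" "y \<in> \<Union>\<C>" for x y
      using fin[of "{x, y}"] that by auto
    have gi: "graded_ideal M" if "M \<in> \<C>" for M using sub that by auto
    have "graded_ideal (\<Union>\<C>)"
      unfolding graded_ideal_def
    proof (intro conjI allI impI)
      show "(d, 0) \<in> \<Union>\<C>" for d
        using ne gi graded_idealD(1) by blast
      show "form {0} d f" if "(d, f) \<in> \<Union>\<C>" for d f
        using that gi graded_idealD(2) by blast
      show "(d, f + g) \<in> \<Union>\<C>" if "(d, f) \<in> \<Union>\<C>" "(d, g) \<in> \<Union>\<C>" for d f g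
        using two[OF that] gi graded_idealD(3) by blast
      show "(d + e, s * f) \<in> \<Union>\<C>" if "(d, f) \<in> \<Union>\<C>" "form {0} e s" for d e f s
        using that gi graded_idealD(4) by blast
    qed
    moreover have "relevant (\<Union>\<C>)"
      unfolding relevant_def
    proof (intro allI, rule ccontr)
      fix d assume all: "\<nexists>f. form {0} d f \<and> (d, f) \<notin> \<Union>\<C>"
      obtain B :: "('k ^ 'n \<Rightarrow> 'k) set" where B: "finite B" "\<forall>b\<in>B. form {0} d b"
        "\<forall>f. form {0} d f \<longrightarrow> (\<exists>c. f = (\<Sum>b\<in>B. (\<lambda>_. c b :: 'k) * b))"
        using form_finitely_generated[of "{0 :: 'k ^ 'n}" d] by (elim exE conjE)
      have "Pair d ` B \<subseteq> \<Union>\<C>" using B(2) all by blast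
      then obtain M where M: "M \<in> \<C>" "Pair d ` B \<subseteq> M" using fin B(1) by blast
      have "(d, f) \<in> M" if f: "form {0} d f" for f
      proof -
        obtain c where "f = (\<Sum>b\<in>B. (\<lambda>_. c b) * b)" using B(3)[rule_format, OF f] by (elim exE)
        then show ?thesis
          using M by (auto intro!: graded_ideal_sum graded_ideal_scale gi)
      qed
      then show False using M(1) sub unfolding relevant_def by blast
    qed
    ultimately show ?thesis using ne sub by blast
  qed
  then have "\<exists>M\<in>?A. \<forall>X\<in>?A. M \<subseteq> X \<longrightarrow> X = M"
    using assms by (intro subset_Zorn_nonempty) auto
  then obtain M where M: "M \<in> ?A" "\<forall>X\<in>?A. M \<subseteq> X \<longrightarrow> X = M" by (elim bexE)
  show thesis
  proof (rule that)
    show "M' = M" if "M \<subseteq> M'" "graded_ideal M'" "relevant M'" for M'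
      using M that by (metis (mono_tags, lifting) mem_Collect_eq order_trans)
  qed (use M(1) in auto)
qed

text \<open>
  A maximal relevant ideal turns out to be the ideal of a single point. The locale derives this
  from two consequences of maximality: the ideal is prime, and adjoining any further form \<open>f\<close> yields
  an ideal that contains all forms of some degree.
\<close>

locale maximal_relevant_ideal =
  fixes J :: "(nat \<times> ('k :: alg_closed_field ^ 'n :: finite \<Rightarrow> 'k)) set"
  assumes ideal: "graded_ideal J" and relevant: "relevant J"
    and maximal: "\<And>M. J \<subseteq> M \<Longrightarrow> graded_ideal M \<Longrightarrow> relevant M \<Longrightarrow> M = J"
begin

definition adjoin :: "nat \<Rightarrow> ('k ^ 'n \<Rightarrow> 'k) \<Rightarrow> (nat \<times> ('k ^ 'n \<Rightarrow> 'k)) set" where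
  "adjoin d f = J \<union> {(e + d, j + u * f) | e j u. (e + d, j) \<in> J \<and> form {0} e u}"

lemma graded_ideal_adjoin:
  assumes f: "form {0} d f"
  shows "graded_ideal (adjoin d f)"
proof -
  have mem: "(n, h) \<in> adjoin d f \<longleftrightarrow> (n, h) \<in> J \<or>
    (\<exists>e j u. n = e + d \<and> h = j + u * f \<and> (n, j) \<in> J \<and> form {0} e u)" for n h
    unfolding adjoin_def by blast
  show ?thesis
    unfolding graded_ideal_def
  proof (intro conjI allI impI)
    show "(n, 0) \<in> adjoin d f" for n
      using graded_idealD(1)[OF ideal] by (simp add: mem)
    show "form {0} n h" if "(n, h) \<in> adjoin d f" for n h
      using that graded_idealD(2)[OF ideal] form_mult[OF _ f] unfolding mem by (blast intro: form_add)
    show "(n, h + h') \<in> adjoin d f" if hh: "(n, h) \<in> adjoin d f" "(n, h') \<in> adjoin d f" for n h h'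
    proof -
      consider "(n, h) \<in> J" "(n, h') \<in> J"
        | e j u where "n = e + d" "(n, j) \<in> J" "form {0} e u" "h = j + u * f" "(n, h') \<in> J"
        | e j u where "n = e + d" "(n, j) \<in> J" "form {0} e u" "h' = j + u * f" "(n, h) \<in> J"
        | e j u j' u' where "n = e + d" "(n, j) \<in> J" "form {0} e u" "h = j + u * f"
            "(n, j') \<in> J" "form {0} e u'" "h' = j' + u' * f"
        using hh unfolding mem by (metis add_right_cancel)
      then show ?thesis
      proof cases
        case 1
        then show ?thesis using graded_idealD(3)[OF ideal] mem by simp
      next
        case 2
        have "h + h' = (j + h') + u * f" using 2 by (simp add: algebra_simps)
        then show ?thesis using 2 graded_idealD(3)[OF ideal 2(2,5)] mem by blast
      next
        case 3
        have "h + h' = (j + h) + u * f" using 3 by (simp add: algebra_simps)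
        then show ?thesis using 3 graded_idealD(3)[OF ideal 3(2,5)] mem by blast
      next
        case 4
        have "h + h' = (j + j') + (u + u') * f" using 4 by (simp add: algebra_simps)
        then show ?thesis using 4 graded_idealD(3)[OF ideal 4(2,5)] mem form_add by blast
      qed
    qed
    show "(n + e', s * h) \<in> adjoin d f" if h: "(n, h) \<in> adjoin d f" and s: "form {0} e' s" for n e' h s
    proof -
      consider "(n, h) \<in> J" | e j u where "n = e + d" "(n, j) \<in> J" "form {0} e u" "h = j + u * f"
        using h unfolding mem by blast
      then show ?thesis
      proof cases
        case 1
        then show ?thesis using graded_idealD(4)[OF ideal 1 s] mem by simp
      next
        case 2
        have "s * h = s * j + (s * u) * f" "n + e' = (e' + e) + d" using 2 by (simp_all add: algebra_simps)
        then show ?thesis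
          using graded_idealD(4)[OF ideal 2(2) s] form_mult[OF s 2(3)] mem by blast
      qed
    qed
  qed
qed

lemma adjoin_irrelevant:
  assumes "form {0} d f" "(d, f) \<notin> J"
  obtains N where "\<And>g. form {0} N g \<Longrightarrow> (N, g) \<in> adjoin d f"
proof -
  have "(d, 0 + 1 * f) \<in> adjoin d f"
    unfolding adjoin_def using graded_idealD(1)[OF ideal, of d] form_one by force
  then have "(d, f) \<in> adjoin d f" by simp
  then have "\<not> relevant (adjoin d f)"
    using maximal[OF _ graded_ideal_adjoin[OF assms(1)]] assms(2) unfolding adjoin_def by blast
  then show thesis using that unfolding relevant_def by blast
qed

lemma not_all: "\<not> (\<forall>f. form {0} d f \<longrightarrow> (d, f) \<in> J)"
  using relevant unfolding relevant_def by blast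

text \<open>
  If \<open>adjoin d f\<close> contains all forms of degree \<open>M\<close> and \<open>adjoin e g\<close> all those of degree \<open>N\<close>, then
  multiplying the two representations shows that \<open>f * g \<in> J\<close> would put all forms of degree
  \<open>M + N\<close> into \<open>J\<close>.
\<close>

lemma prime:
  assumes f: "form {0} d f" "(d, f) \<notin> J" and g: "form {0} e g" "(e, g) \<notin> J"
  shows "(d + e, f * g) \<notin> J"
proof
  assume fg: "(d + e, f * g) \<in> J"
  obtain M N where M: "\<And>h. form {0} M h \<Longrightarrow> (M, h) \<in> adjoin d f"
    and N: "\<And>h. form {0} N h \<Longrightarrow> (N, h) \<in> adjoin e g"
    using adjoin_irrelevant[OF f] adjoin_irrelevant[OF g] by metis
  have "(M + N, p * q) \<in> J" if p: "form {0} M p" and q: "form {0} N q" for p q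
  proof -
    consider "(M, p) \<in> J" | "(N, q) \<in> J" | m j u n j' u' where
      "M = m + d" "(M, j) \<in> J" "form {0} m u" "p = j + u * f"
      "N = n + e" "(N, j') \<in> J" "form {0} n u'" "q = j' + u' * g"
      using M[OF p] N[OF q] unfolding adjoin_def by blast
    then show ?thesis
    proof cases
      case 1
      then show ?thesis using graded_idealD(4)[OF ideal 1 q] by (simp add: mult.commute)
    next
      case 2
      then show ?thesis using graded_idealD(4)[OF ideal 2 p] by (simp add: add.commute)
    next
      case 3
      have "(M + N, q * j) \<in> J" using graded_idealD(4)[OF ideal 3(2) q] .
      moreover have "(N + M, (u * f) * j') \<in> J"
        using graded_idealD(4)[OF ideal 3(6), of M "u * f"] form_mult[OF 3(3) f(1)] 3(1) by simp
      moreover have "((d + e) + (m + n), (u * u') * (f * g)) \<in> J"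
        using graded_idealD(4)[OF ideal fg form_mult[OF 3(3,7)]] .
      then have "(M + N, (u * u') * (f * g)) \<in> J" using 3 by (simp add: add_ac)
      ultimately have "(M + N, q * j + (u * f) * j' + (u * u') * (f * g)) \<in> J"
        by (auto intro!: graded_idealD(3)[OF ideal] simp: add.commute)
      moreover have "q * j + (u * f) * j' + (u * u') * (f * g) = p * q"
        using 3 by (simp add: algebra_simps)
      ultimately show ?thesis by simp
    qed
  qed
  then show False using graded_ideal_products[OF ideal] not_all by blast
qed

lemma power_notin:
  assumes "form {0} d f" "(d, f) \<notin> J" shows "(d * k, f ^ k) \<notin> J"
proof (induction k)
  case 0
  have "(0, 1) \<notin> J"
  proof
    assume "(0, 1) \<in> J"
    then have "(0, s) \<in> J" if "form {0} 0 s" for s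
      using graded_idealD(4)[OF ideal _ that, of 0 1] by simp
    then show False using not_all[of 0] by blast
  qed
  then show ?case by simp
next
  case (Suc k)
  show ?case using prime[OF assms form_power[OF assms(1)] Suc] by simp
qed

text \<open>
  Over an algebraically closed field a binary form in \<open>x\<close> and \<open>t\<close> is a product of linear forms, and a
  prime ideal containing the product contains a factor; the factor is not \<open>t\<close> by assumption.
\<close>

lemma binary_form_splits:
  assumes t: "form {0} 1 t" "(1, t) \<notin> J" and x: "form {0} 1 x"
  shows "q \<noteq> 0 \<Longrightarrow> degree q \<le> m \<Longrightarrow> (m, \<Sum>i\<le>degree q. (\<lambda>_. coeff q i) * (x ^ i * t ^ (m - i))) \<in> J \<Longrightarrow>
    \<exists>\<alpha>. (1, x - (\<lambda>_. \<alpha>) * t) \<in> J"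
proof (induction "degree q" arbitrary: q m)
  case 0
  then obtain c where q: "q = [:c:]" "c \<noteq> 0" by (metis pCons_0_0 degree_eq_zeroE)
  then have "(m, (\<lambda>_. c) * t ^ m) \<in> J" using 0 by simp
  then have "(m, (\<lambda>_. 1 / c) * ((\<lambda>_. c) * t ^ m)) \<in> J" by (rule graded_ideal_scale[OF ideal])
  moreover have "(\<lambda>_. 1 / c) * ((\<lambda>_. c) * t ^ m) = t ^ m" using q(2) by (auto simp: fun_eq_iff pointwise)
  ultimately show ?case using power_notin[OF t, of m] by simp
next
  case (Suc D)
  then obtain \<alpha> where "poly q \<alpha> = 0"
    using alg_closed_imp_poly_has_root[of q] by auto
  then obtain r where r: "q = [:-\<alpha>, 1:] * r" by (metis dvdE poly_eq_0_iff_dvd)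
  then have "r \<noteq> 0" using Suc by auto
  then have degq: "degree q = Suc (degree r)" unfolding r by (subst degree_mult_eq) auto
  then obtain m' where m: "m = Suc m'" using Suc by (cases m) auto
  have deg: "D = degree r" "degree r \<le> m'" using degq Suc m by auto
  let ?F = "\<lambda>q m. \<Sum>i\<le>degree q. (\<lambda>_. coeff q i) * (x ^ i * t ^ (m - i))"
  have form_F: "form {0} m' (?F r m')"
  proof (rule form_sum, rule form_scale)
    fix i assume "i \<in> {..degree r}"
    then show "form {0} m' (x ^ i * t ^ (m' - i))"
      using form_mult[OF form_power[OF x, of i] form_power[OF t(1), of "m' - i"]] deg by simp
  qed
  have coeff: "coeff q i = (case i of 0 \<Rightarrow> 0 | Suc j \<Rightarrow> coeff r j) - \<alpha> * coeff r i" for i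
    unfolding r by (cases i) (auto simp: coeff_pCons)
  have "?F q m = (x - (\<lambda>_. \<alpha>) * t) * ?F r m'"
  proof
    fix y
    have t_split: "t y ^ (m - i) = t y * t y ^ (m' - i)" if "i \<le> degree r" for i
      using that deg m by (simp add: Suc_diff_le)
    have "?F q m y = (\<Sum>i\<le>Suc (degree r). (case i of 0 \<Rightarrow> 0 | Suc j \<Rightarrow> coeff r j) * (x y ^ i * t y ^ (m - i)))
        - (\<Sum>i\<le>Suc (degree r). \<alpha> * coeff r i * (x y ^ i * t y ^ (m - i)))"
      by (simp only: pointwise coeff degq left_diff_distrib sum_subtractf)
    also have "(\<Sum>i\<le>Suc (degree r). (case i of 0 \<Rightarrow> 0 | Suc j \<Rightarrow> coeff r j) * (x y ^ i * t y ^ (m - i)))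
        = (\<Sum>i\<le>degree r. coeff r i * (x y ^ Suc i * t y ^ (m' - i)))"
      by (subst sum.atMost_Suc_shift) (simp add: m)
    also have "(\<Sum>i\<le>Suc (degree r). \<alpha> * coeff r i * (x y ^ i * t y ^ (m - i)))
        = (\<Sum>i\<le>degree r. \<alpha> * coeff r i * (x y ^ i * (t y * t y ^ (m' - i))))"
      using t_split by (simp add: coeff_eq_0)
    finally show "?F q m y = ((x - (\<lambda>_. \<alpha>) * t) * ?F r m') y"
      by (simp add: pointwise sum_distrib_left sum_subtractf[symmetric] algebra_simps)
  qed
  then have "(1 + m', (x - (\<lambda>_. \<alpha>) * t) * ?F r m') \<in> J" using Suc m by simp
  moreover have "form {0} 1 (x - (\<lambda>_. \<alpha>) * t)" by (intro form_diff x form_scale t(1))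
  ultimately have "(1, x - (\<lambda>_. \<alpha>) * t) \<in> J \<or> (m', ?F r m') \<in> J"
    using prime[OF _ _ form_F] by blast
  then show ?case using Suc.hyps(1)[OF deg(1) \<open>r \<noteq> 0\<close> deg(2)] by blast
qed

text \<open>
  Modulo \<open>J\<close>, every form of large degree \<open>N + k\<close> is \<open>t ^ k\<close> times a form of degree \<open>N\<close>. The space of
  forms of degree \<open>N\<close> is spanned by finitely many, say \<open>D\<close>, elements, so the \<open>D + 1\<close> monomials \<open>x ^ i * t ^ (N + D - i)\<close> with
  \<open>i \<le> D\<close> are linearly dependent modulo \<open>J\<close>. The dependence is a binary form in \<open>J\<close>.
\<close>

lemma linear_form_proportional:
  assumes t: "form {0} 1 t" "(1, t) \<notin> J" and x: "form {0} 1 x"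
  shows "\<exists>\<alpha>. (1, x - (\<lambda>_. \<alpha>) * t) \<in> J"
proof -
  obtain N where N: "\<And>h. form {0} N h \<Longrightarrow> (N, h) \<in> adjoin 1 t"
    using adjoin_irrelevant[OF t] by blast
  have N': "(N + k, h) \<in> adjoin 1 t" if h: "form {0} (N + k) h" for k h
  proof -
    have "(N + k, p * q) \<in> adjoin 1 t" if "form {0} N p" "form {0} k q" for p q
      using graded_idealD(4)[OF graded_ideal_adjoin[OF t(1)] N[OF that(1)] that(2)] by (simp add: mult.commute)
    then show ?thesis
      using graded_ideal_products[OF graded_ideal_adjoin[OF t(1)] h] by blast
  qed
  have reduce: "\<exists>u. form {0} N u \<and> (N + k, h - u * t ^ k) \<in> J" if h: "form {0} (N + k) h" for k h
    using h
  proof (induction k arbitrary: h)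
    case 0
    then show ?case using graded_idealD(1)[OF ideal] by (intro exI[of _ h]) simp
  next
    case (Suc k)
    have "(N + Suc k, h) \<in> adjoin 1 t" using N'[OF Suc.prems] .
    then consider "(N + Suc k, h) \<in> J" | e j u where "N + Suc k = e + 1" "(N + Suc k, j) \<in> J" "form {0} e u" "h = j + u * t"
      unfolding adjoin_def by auto
    then show ?case
    proof cases
      case 1
      then show ?thesis by (intro exI[of _ 0]) (simp add: form_zero)
    next
      case 2
      then have "form {0} (N + k) u" by simp
      then obtain u' where u': "form {0} N u'" "(N + k, u - u' * t ^ k) \<in> J"
        using Suc.IH by blast
      then have "(N + Suc k, t * (u - u' * t ^ k)) \<in> J"
        using graded_idealD(4)[OF ideal u'(2) t(1)] by simp
      then have "(N + Suc k, j + t * (u - u' * t ^ k)) \<in> J"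
        using graded_idealD(3)[OF ideal 2(2)] by simp
      moreover have "j + t * (u - u' * t ^ k) = h - u' * t ^ Suc k"
        using 2 by (simp add: algebra_simps)
      ultimately show ?thesis using u'(1) by auto
    qed
  qed
  obtain B :: "('k ^ 'n \<Rightarrow> 'k) set" where B: "finite B" "\<forall>b\<in>B. form {0} N b"
    "\<forall>f. form {0} N f \<longrightarrow> (\<exists>c. f = (\<Sum>b\<in>B. (\<lambda>_. c b :: 'k) * b))"
    using form_finitely_generated[of "{0 :: 'k ^ 'n}" N] by (elim exE conjE)
  define D where "D = card B"
  define comb where "comb c = (\<Sum>b\<in>B. (\<lambda>_. c b :: 'k) * b)" for c
  have "\<exists>c. (N + D, x ^ i * t ^ (N + D - i) - comb c * t ^ D) \<in> J" if i: "i \<le> D" for i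
  proof -
    have "form {0} (N + D) (x ^ i * t ^ (N + D - i))"
      using form_mult[OF form_power[OF x, of i] form_power[OF t(1), of "N + D - i"]] i by simp
    from reduce[OF this] obtain u where u: "form {0} N u" "(N + D, x ^ i * t ^ (N + D - i) - u * t ^ D) \<in> J"
      by blast
    obtain c where "u = comb c" unfolding comb_def using B(3) u(1) by (elim allE impE exE)
    then show ?thesis using u(2) by blast
  qed
  then obtain c where c: "\<And>i. i \<le> D \<Longrightarrow>
      (N + D, x ^ i * t ^ (N + D - i) - comb (c i) * t ^ D) \<in> J"
    by metis
  have "\<exists>p E. (\<forall>i\<in>{..D}. p i \<noteq> 0 \<longrightarrow> (\<exists>q. p i \<in> UNIV \<and> q + (0 :: nat) = E)) \<and>
      (\<exists>i\<in>{..D}. p i \<noteq> 0) \<and> (\<forall>b\<in>B. (\<Sum>i\<in>{..D}. p i * c i b) = 0)"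
    by (rule homogeneous_dependence) (use B(1) in \<open>auto simp: D_def\<close>)
  then obtain p i0 where p: "i0 \<le> D" "p i0 \<noteq> 0" and dep: "\<And>b. b \<in> B \<Longrightarrow> (\<Sum>i\<le>D. p i * c i b) = 0"
    by auto
  define q where "q = (\<Sum>i\<le>D. monom (p i) i)"
  have coeff_q: "coeff q i = (if i \<le> D then p i else 0)" for i
    unfolding q_def by (simp add: coeff_sum)
  have "q \<noteq> 0" using coeff_q[of i0] p by auto
  moreover have degq: "degree q \<le> D" by (rule degree_le) (simp add: coeff_q)
  moreover have "(N + D, \<Sum>i\<le>degree q. (\<lambda>_. coeff q i) * (x ^ i * t ^ (N + D - i))) \<in> J"
  proof -
    let ?S = "\<Sum>i\<le>D. (\<lambda>_. p i) * (x ^ i * t ^ (N + D - i) - comb (c i) * t ^ D)"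
    have "(N + D, ?S) \<in> J"
      using c by (intro graded_ideal_sum graded_ideal_scale ideal) auto
    moreover have "?S = (\<Sum>i\<le>degree q. (\<lambda>_. coeff q i) * (x ^ i * t ^ (N + D - i)))"
    proof
      fix y
      have "(\<Sum>i\<le>D. p i * (\<Sum>b\<in>B. c i b * b y)) = (\<Sum>b\<in>B. (\<Sum>i\<le>D. p i * c i b) * b y)"
        unfolding sum_distrib_left sum_distrib_right by (subst sum.swap) (simp add: mult_ac)
      also have "\<dots> = 0" using dep by simp
      finally have z: "(\<Sum>i\<le>D. p i * (\<Sum>b\<in>B. c i b * b y)) = 0" .
      have "?S y = (\<Sum>i\<le>D. p i * (x y ^ i * t y ^ (N + D - i))) - (\<Sum>i\<le>D. p i * (\<Sum>b\<in>B. c i b * b y)) * t y ^ D"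
        by (simp add: comb_def pointwise right_diff_distrib sum_subtractf sum_distrib_right mult.assoc)
      also have "\<dots> = (\<Sum>i\<le>D. coeff q i * (x y ^ i * t y ^ (N + D - i)))"
        by (simp add: z coeff_q)
      also have "\<dots> = (\<Sum>i\<le>degree q. coeff q i * (x y ^ i * t y ^ (N + D - i)))"
        using degq by (intro sum.mono_neutral_right) (auto simp: coeff_eq_0)
      finally show "?S y = (\<Sum>i\<le>degree q. (\<lambda>_. coeff q i) * (x ^ i * t ^ (N + D - i))) y"
        by (simp add: pointwise)
    qed
    ultimately show ?thesis by simp
  qed
  ultimately show ?thesis using binary_form_splits[OF t x, of q "N + D"] by simp
qed

text \<open>
  Each coordinate is congruent modulo \<open>J\<close> to a multiple of \<open>t\<close>. The vector \<open>a\<close> of the factors satisfies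
  \<open>f \<equiv> f a * t ^ d\<close> for every form \<open>f\<close> of degree \<open>d\<close>, and no power of \<open>t\<close> lies in \<open>J\<close>.
\<close>

lemma common_zero: "\<exists>a. a \<noteq> 0 \<and> (\<forall>d f. (d, f) \<in> J \<longrightarrow> f a = 0)"
proof -
  obtain t where t: "form {0} 1 t" "(1, t) \<notin> J" using not_all by blast
  have "\<exists>\<alpha>. (1, dot (axis i 1) - (\<lambda>_. \<alpha>) * t) \<in> J" for i
    by (intro linear_form_proportional t form_linear) simp
  then obtain \<alpha> where \<alpha>: "\<And>i. (1, dot (axis i 1) - (\<lambda>_. \<alpha> i) * t) \<in> J" by metis
  define a :: "'k ^ 'n" where "a = (\<chi> i. \<alpha> i)"
  have lin: "(1, dot c - (\<lambda>_. dot c a) * t) \<in> J" for c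
  proof -
    have "(1, \<Sum>i\<in>UNIV. (\<lambda>_. c $ i) * (dot (axis i 1) - (\<lambda>_. \<alpha> i) * t)) \<in> J"
      by (intro graded_ideal_sum graded_ideal_scale ideal \<alpha>)
    moreover have "(\<Sum>i\<in>UNIV. (\<lambda>_. c $ i) * (dot (axis i 1) - (\<lambda>_. \<alpha> i) * t)) = dot c - (\<lambda>_. dot c a) * t"
      by (simp add: fun_eq_iff pointwise a_def dot_def[of c] right_diff_distrib sum_subtractf sum_distrib_right mult.assoc)
    ultimately show ?thesis by simp
  qed
  have eval: "(d, f - (\<lambda>_. f a) * t ^ d) \<in> J" if "form {0} d f" for d f
    using that
  proof (induction rule: form.induct)
    case (form_zero d)
    have "0 - (\<lambda>_. 0 a) * t ^ d = (0 :: 'k ^ 'n \<Rightarrow> 'k)" by (auto simp: fun_eq_iff pointwise)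
    then show ?case using graded_idealD(1)[OF ideal] by simp
  next
    case (form_const c)
    have "(\<lambda>_. c) - (\<lambda>_. c) * t ^ 0 = (0 :: 'k ^ 'n \<Rightarrow> 'k)" by (auto simp: fun_eq_iff pointwise)
    then show ?case using graded_idealD(1)[OF ideal] by simp
  next
    case (form_add d f g)
    have "(f + g) - (\<lambda>_. (f + g) a) * t ^ d = (f - (\<lambda>_. f a) * t ^ d) + (g - (\<lambda>_. g a) * t ^ d)"
      by (auto simp: fun_eq_iff pointwise algebra_simps)
    then show ?case using graded_idealD(3)[OF ideal form_add.IH] by metis
  next
    case (form_dot c d f)
    have "(d + 1, dot c * (f - (\<lambda>_. f a) * t ^ d)) \<in> J"
      by (rule graded_idealD(4)[OF ideal form_dot.IH]) (simp add: form_linear del: One_nat_def)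
    moreover have "(1 + d, ((\<lambda>_. f a) * t ^ d) * (dot c - (\<lambda>_. dot c a) * t)) \<in> J"
      by (rule graded_idealD(4)[OF ideal lin]) (use form_scale[OF form_power[OF t(1), of d]] in simp)
    ultimately have "(Suc d, dot c * (f - (\<lambda>_. f a) * t ^ d) + ((\<lambda>_. f a) * t ^ d) * (dot c - (\<lambda>_. dot c a) * t)) \<in> J"
      using graded_idealD(3)[OF ideal] by simp
    moreover have "dot c * (f - (\<lambda>_. f a) * t ^ d) + ((\<lambda>_. f a) * t ^ d) * (dot c - (\<lambda>_. dot c a) * t)
        = dot c * f - (\<lambda>_. (dot c * f) a) * t ^ Suc d"
      by (auto simp: fun_eq_iff pointwise algebra_simps)
    ultimately show ?case by simp
  qed
  have zero: "f a = 0" if "(d, f) \<in> J" for d f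
  proof (rule ccontr)
    assume nz: "f a \<noteq> 0"
    have "(d, f - (f - (\<lambda>_. f a) * t ^ d)) \<in> J"
      using graded_ideal_diff[OF ideal that eval] graded_idealD(2)[OF ideal that] by blast
    then have "(d, (\<lambda>_. 1 / f a) * (f - (f - (\<lambda>_. f a) * t ^ d))) \<in> J"
      by (rule graded_ideal_scale[OF ideal])
    moreover have "(\<lambda>_. 1 / f a) * (f - (f - (\<lambda>_. f a) * t ^ d)) = t ^ d"
      using nz by (auto simp: fun_eq_iff pointwise)
    ultimately show False using power_notin[OF t, of d] by simp
  qed
  have "t a \<noteq> 0"
  proof
    assume "t a = 0"
    then have "t - (\<lambda>_. t a) * t ^ 1 = t" by (auto simp: fun_eq_iff pointwise)
    then show False using eval[OF t(1)] t(2) by simp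
  qed
  moreover have "t 0 = 0" using form_homogeneous[OF t(1), of 0 0] by simp
  ultimately have "a \<noteq> 0" by metis
  then show ?thesis using zero by blast
qed

end

theorem projective_nullstellensatz:
  fixes J :: "(nat \<times> ('k :: alg_closed_field ^ 'n :: finite \<Rightarrow> 'k)) set"
  assumes ideal: "graded_ideal J" and no_zero: "\<And>x. x \<noteq> 0 \<Longrightarrow> \<exists>d f. (d, f) \<in> J \<and> f x \<noteq> 0"
  obtains N where "\<And>d f. N \<le> d \<Longrightarrow> form {0} d f \<Longrightarrow> (d, f) \<in> J"
proof -
  have "\<not> relevant J"
  proof
    assume "relevant J"
    then obtain M where M: "J \<subseteq> M" "graded_ideal M" "relevant M"
      "\<And>M'. M \<subseteq> M' \<Longrightarrow> graded_ideal M' \<Longrightarrow> relevant M' \<Longrightarrow> M' = M"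
      using relevant_maximal_exists[OF ideal] by blast
    interpret maximal_relevant_ideal M by standard (use M in auto)
    show False using common_zero no_zero M(1) by blast
  qed
  then obtain N where N: "\<And>f. form {0} N f \<Longrightarrow> (N, f) \<in> J"
    unfolding relevant_def by blast
  have "(N + e, f) \<in> J" if "form {0} (N + e) f" for e f
    using graded_ideal_products[OF ideal that] graded_idealD(4)[OF ideal N]
    by (simp add: mult.commute)
  then show thesis using that[of N] by (metis le_add_diff_inverse)
qed

section \<open>Algebra over the projection from a centre\<close>

text \<open>
  The affine cone over an irreducible closed subset of projective space, described through forms only.
\<close>

locale irreducible_cone =
  fixes C :: "('k :: {alg_closed_field, field_char_0} ^ 'n :: finite) set"
  assumes zero_mem: "0 \<in> C" and scale: "\<And>a x. x \<in> C \<Longrightarrow> a *s x \<in> C"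
    and nontrivial: "\<exists>x\<in>C. x \<noteq> 0"
    and closed: "\<And>v. v \<notin> C \<Longrightarrow> \<exists>d f. form {0} d f \<and> (\<forall>x\<in>C. f x = 0) \<and> f v \<noteq> 0"
    and prime: "\<And>d e f g. form {0} d f \<Longrightarrow> form {0} e g \<Longrightarrow> (\<forall>x\<in>C. f x * g x = 0) \<Longrightarrow>
      (\<forall>x\<in>C. f x = 0) \<or> (\<forall>x\<in>C. g x = 0)"
begin

text \<open>
  The forms \<open>f\<close> with \<open>f * h\<close> in the \<open>e\<close>-th power of the ideal of \<open>U\<close> make up a graded ideal. It has no
  zero off \<open>C\<close>, because it contains all forms vanishing on \<open>C\<close>, none off \<open>U\<close>, because it contains the
  \<open>e\<close>-th powers of the linear forms vanishing on \<open>U\<close>, and none on \<open>C \<inter> U\<close> by the local hypothesis.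
  By the Nullstellensatz it contains all forms of large degree. Thus a vanishing order that is known locally holds for all multiples of \<open>h\<close> of large degree.
\<close>

lemma saturation:
  assumes U: "vec.subspace U" and h: "form {0} m h"
    and loc: "\<And>q. q \<in> C \<Longrightarrow> q \<noteq> 0 \<Longrightarrow> q \<in> U \<Longrightarrow>
      \<exists>n s. form {0} n s \<and> s q \<noteq> 0 \<and> ideal_power C U e (n + m) (s * h)"
  obtains N where "\<And>n f. N \<le> n \<Longrightarrow> form {0} n f \<Longrightarrow> ideal_power C U e (n + m) (f * h)"
proof -
  define J where "J = {(n, f). form {0} n f \<and> ideal_power C U e (n + m) (f * h)}"
  have J: "(n, f) \<in> J \<longleftrightarrow> form {0} n f \<and> ideal_power C U e (n + m) (f * h)" for n f
    by (simp add: J_def)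
  have "graded_ideal J"
    unfolding graded_ideal_def
  proof (intro conjI allI impI)
    show "(d, 0) \<in> J" for d
      unfolding J by (auto intro: form_zero ideal_power_zero simp: pointwise)
    show "form {0} d f" if "(d, f) \<in> J" for d f using that J by blast
    show "(d, f + g) \<in> J" if "(d, f) \<in> J" "(d, g) \<in> J" for d f g
      using that unfolding J distrib_right by (auto intro: form_add ideal_power_add)
    show "(d + n, s * f) \<in> J" if "(d, f) \<in> J" "form {0} n s" for d n f s
      using that ideal_power_mult_form[of C U e "d + m" "f * h" n s] form_mult[of "{0}" n s d f]
      unfolding J by (simp add: add_ac mult_ac)
  qed
  moreover have "\<exists>d f. (d, f) \<in> J \<and> f x \<noteq> 0" if x: "x \<noteq> 0" for x
  proof -
    consider "x \<notin> C" | "x \<in> C" "x \<in> U" | "x \<notin> U" by blast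
    then show ?thesis
    proof cases
      case 1
      then obtain d f where "form {0} d f" "\<forall>x\<in>C. f x = 0" "f x \<noteq> 0" using closed by blast
      moreover from this have "ideal_power C U e (d + m) (f * h)"
        by (intro ideal_power_zero) (simp add: pointwise)
      ultimately show ?thesis unfolding J by blast
    next
      case 2
      then show ?thesis using loc[of x] x unfolding J by blast
    next
      case 3
      then obtain c where c: "c \<in> annihilator U" "dot c x = 1" using separating_functional[OF U] by blast
      have f: "form U e (dot c ^ e)" using form_power[OF form_linear[OF c(1)], of e] by simp
      have "(e, dot c ^ e) \<in> J" unfolding J using f form_weaken[OF f] ideal_power_product[OF f h] by blast
      then show ?thesis using c by (auto intro!: exI simp: pointwise)
    qed
  qed
  ultimately obtain N where "\<And>d f. N \<le> d \<Longrightarrow> form {0} d f \<Longrightarrow> (d, f) \<in> J"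
    using projective_nullstellensatz by blast
  then show thesis using that J by blast
qed

text \<open>
  If \<open>C\<close> misses the centre \<open>U\<close>, then the coordinate ring of \<open>C\<close> is a finite module over the forms on the
  target of the projection, generated in degree \<open>N\<close> as far as degrees \<open>\<ge> N\<close> are concerned. This is
  saturation of the form \<open>1\<close>, for which the local hypothesis is empty.
\<close>

lemma finiteness:
  assumes U: "vec.subspace U" and CU: "C \<inter> U \<subseteq> {0}"
  obtains N where "\<And>k f. form {0} (N + k) f \<Longrightarrow> ideal_power C U k (N + k) f"
proof -
  obtain N where N: "\<And>n f. N \<le> n \<Longrightarrow> form {0} n f \<Longrightarrow> ideal_power C U 1 (n + 0) (f * 1)"
    using saturation[OF U form_one, where e = 1] CU by blast
  have "ideal_power C U k (N + k) f" if "form {0} (N + k) f" for k f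
    using that
  proof (induction k arbitrary: f)
    case 0
    then show ?case using ideal_power_product[OF form_one, of _ _ _ C U] by force
  next
    case (Suc k)
    have "ideal_power C U 1 (N + Suc k) f" using N[OF _ Suc.prems] by simp
    then show ?case
    proof (induction rule: ideal_power.induct)
      case (ideal_power_zero f)
      then show ?case by (rule ideal_power.ideal_power_zero)
    next
      case (ideal_power_step h g n s f)
      then have "form {0} (N + k) s" by simp
      then have "ideal_power C U (k + 1) (N + k + 1) (g * s)"
        using ideal_power_mult_order[OF Suc.IH ideal_power_step.hyps(2)] by blast
      then have "ideal_power C U (Suc k) (N + Suc k) (g * s + h)"
        using ideal_power_step.IH by (auto intro: ideal_power_add)
      then show ?case by (rule ideal_power_cong) (simp add: ideal_power_step.hyps pointwise)
    qed
  qed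
  then show thesis using that by blast
qed

text \<open>
  Multiplication by \<open>f\<close> maps the forms of degree \<open>N\<close> on \<open>C\<close> into their combinations with coefficients
  that are forms of degree \<open>e\<close> in the linear forms vanishing on \<open>U\<close>. This is the usual criterion for
  \<open>f\<close> to be integral over the ring of these forms.
\<close>

definition acts :: "('k ^ 'n) set \<Rightarrow> nat \<Rightarrow> nat \<Rightarrow> ('k ^ 'n \<Rightarrow> 'k) \<Rightarrow> bool" where
  "acts U N e f \<longleftrightarrow> form {0} e f \<and> (\<forall>s. form {0} N s \<longrightarrow> ideal_power C U e (N + e) (s * f))"

lemma acts_form: "form U e f \<Longrightarrow> acts U N e f"
  unfolding acts_def using ideal_power_product[of U e f N _ _ C] form_weaken
  by (auto simp: mult.commute add.commute)

lemma acts_add: "acts U N e f \<Longrightarrow> acts U N e g \<Longrightarrow> acts U N e (f + g)"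
  unfolding acts_def by (auto simp: distrib_left intro: form_add ideal_power_add)

lemma acts_mult:
  assumes f: "acts U N e f" and g: "acts U N e' g"
  shows "acts U N (e + e') (f * g)"
proof -
  have "ideal_power C U (e + e') (N + (e + e')) (f * h)" if "ideal_power C U e' (N + e') h" for h
    using that
  proof (induction rule: ideal_power.induct)
    case (ideal_power_zero h)
    then show ?case by (auto intro!: ideal_power.ideal_power_zero simp: pointwise)
  next
    case (ideal_power_step h' g n s h)
    then have "ideal_power C U e (N + e) (s * f)"
      using f by (auto simp: acts_def)
    then have "ideal_power C U (e + e') (N + (e + e')) (g * (s * f))"
      using ideal_power_mult_order ideal_power_step.hyps(2) by (metis add.assoc)
    from ideal_power_add[OF this ideal_power_step.IH] show ?case
      by (rule ideal_power_cong) (simp add: ideal_power_step.hyps(5) pointwise algebra_simps)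
  qed
  then have "ideal_power C U (e + e') (N + (e + e')) (f * (s * g))" if "form {0} N s" for s
    using g that unfolding acts_def by blast
  then show ?thesis
    using g form_mult[of "{0}" e f e' g] f unfolding acts_def by (simp add: mult.left_commute)
qed

lemma acts_power: "acts U N e f \<Longrightarrow> acts U N (e * k) (f ^ k)"
  by (induction k) (auto intro: acts_mult acts_form form_one)

lemma acts_sum: "(\<And>i. i \<in> A \<Longrightarrow> acts U N e (f i)) \<Longrightarrow> acts U N e (sum f A)"
  by (induction A rule: infinite_finite_induct) (auto intro: acts_add acts_form form_zero)

lemma all_forms_act:
  assumes "vec.subspace U" "C \<inter> U \<subseteq> {0}"
  obtains N where "\<And>e f. form {0} e f \<Longrightarrow> acts U N e f"
proof -
  obtain N where "\<And>k f. form {0} (N + k) f \<Longrightarrow> ideal_power C U k (N + k) f"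
    using finiteness[OF assms] by blast
  then have "acts U N e f" if "form {0} e f" for e f
    unfolding acts_def using that form_mult by blast
  then show thesis using that by blast
qed

text \<open>
  A nontrivial homogeneous polynomial equation of total degree \<open>E\<close> for \<open>f\<close> on \<open>C\<close>, with coefficients
  among the forms on the target of the projection from \<open>U\<close>.
\<close>

definition algebraic_relation ::
  "('k ^ 'n) set \<Rightarrow> nat \<Rightarrow> ('k ^ 'n \<Rightarrow> 'k) \<Rightarrow> nat \<Rightarrow> nat \<Rightarrow> (nat \<Rightarrow> 'k ^ 'n \<Rightarrow> 'k) \<Rightarrow> bool" where
  "algebraic_relation U e f E D p \<longleftrightarrow>
     (\<forall>k\<le>D. p k \<noteq> 0 \<longrightarrow> e * k \<le> E \<and> form U (E - e * k) (p k)) \<and> (\<exists>k\<le>D. p k \<noteq> 0) \<and>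
     (\<forall>x\<in>C. (\<Sum>k\<le>D. p k x * f x ^ k) = 0)"

lemma relation_term_form:
  assumes "form {0} e f" "p \<noteq> 0 \<longrightarrow> e * k \<le> E \<and> form U (E - e * k) p"
  shows "form {0} E (p * f ^ k)"
proof (cases "p = 0")
  case False
  then show ?thesis
    using assms form_mult[OF form_weaken form_power[OF assms(1)], of U "E - e * k" p k] by simp
qed (simp add: form_zero)

lemma nonvanishing_form: obtains s x where "form {0} N s" "x \<in> C" "s x \<noteq> 0"
proof -
  obtain x where x: "x \<in> C" "x \<noteq> 0" using nontrivial by blast
  then obtain i where i: "x $ i \<noteq> 0" by (auto simp: vec_eq_iff)
  have "form {0} N (dot (axis i 1) ^ N)"
    using form_power[OF form_linear, of "axis i 1" "{0}" N] by simp
  moreover have "(dot (axis i 1) ^ N) x \<noteq> 0" using i by (simp add: pointwise)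
  ultimately show thesis using that x(1) by blast
qed

text \<open>
  Let \<open>B\<close> be a finite spanning set of the forms of degree \<open>N\<close> and \<open>s0\<close> one of these forms that does not
  vanish on \<open>C\<close>. The products of \<open>s0\<close> with the powers \<open>f ^ k\<close>, \<open>k \<le> card B\<close>, have coordinate vectors of
  length \<open>card B\<close>, hence satisfy a linear relation, from which \<open>s0\<close> cancels by irreducibility.
\<close>

lemma acting_imp_relation:
  assumes f: "acts U N e f"
  obtains E D p where "algebraic_relation U e f E D p"
proof -
  obtain B :: "('k ^ 'n \<Rightarrow> 'k) set" where B: "finite B" "\<forall>b\<in>B. form {0} N b"
    "\<forall>f. form {0} N f \<longrightarrow> (\<exists>c. f = (\<Sum>b\<in>B. (\<lambda>_. c b) * b))"
    using form_finitely_generated[of "{0}" N] by (elim exE conjE)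
  obtain s0 x0 where s0: "form {0} N s0" "x0 \<in> C" "s0 x0 \<noteq> 0" using nonvanishing_form .
  have coords: "\<exists>c. (\<forall>b\<in>B. form U d (c b)) \<and> (\<forall>x\<in>C. h x = (\<Sum>b\<in>B. c b x * b x))"
    if "ideal_power C U d (N + d) h" for d h
    using that
  proof (induction rule: ideal_power.induct)
    case (ideal_power_zero h)
    show ?case
    proof (intro exI[of _ "\<lambda>_. 0"] conjI ballI)
      show "form U d 0" by (rule form_zero)
      show "h x = (\<Sum>b\<in>B. 0 x * b x)" if "x \<in> C" for x
        using that by (simp add: zero_fun_apply ideal_power_zero)
    qed
  next
    case (ideal_power_step h' g n s h)
    then obtain c where c: "\<forall>b\<in>B. form U d (c b)" "\<forall>x\<in>C. h' x = (\<Sum>b\<in>B. c b x * b x)" by blast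
    have "form {0} N s" using ideal_power_step.hyps by simp
    then obtain a where a: "s = (\<Sum>b\<in>B. (\<lambda>_. a b) * b)" using B(3) by (elim allE impE exE)
    have "\<forall>b\<in>B. form U d ((\<lambda>_. a b) * g + c b)"
      using c(1) ideal_power_step.hyps(2) by (auto intro: form_add form_scale)
    moreover have "\<forall>x\<in>C. h x = (\<Sum>b\<in>B. ((\<lambda>_. a b) * g + c b) x * b x)"
      using c(2) ideal_power_step.hyps(5)
      by (simp add: a pointwise sum_distrib_left sum.distrib[symmetric] algebra_simps)
    ultimately show ?case by (intro exI[of _ "\<lambda>b. (\<lambda>_. a b) * g + c b"]) blast
  qed
  have power_acts: "ideal_power C U (e * k) (N + e * k) (s0 * f ^ k)" for k
    using acts_power[OF f] s0(1) unfolding acts_def by blast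
  define coord where "coord k c \<longleftrightarrow> (\<forall>b\<in>B. form U (e * k) (c b)) \<and>
      (\<forall>x\<in>C. (s0 * f ^ k) x = (\<Sum>b\<in>B. c b x * b x))" for k c
  have "\<exists>c. coord k c" for k
    unfolding coord_def using coords[OF power_acts] .
  then obtain c where "\<And>k. coord k (c k)" by metis
  then have c: "\<And>k. \<forall>b\<in>B. form U (e * k) (c k b)"
      "\<And>k. \<forall>x\<in>C. (s0 * f ^ k) x = (\<Sum>b\<in>B. c k b x * b x)"
    unfolding coord_def by blast+
  let ?G = "\<lambda>d. {g. form U d g}" and ?D = "card B"
  have "\<exists>p E. (\<forall>k\<in>{..?D}. p k \<noteq> 0 \<longrightarrow> (\<exists>q. p k \<in> ?G q \<and> q + e * k = E)) \<and> (\<exists>k\<in>{..?D}. p k \<noteq> 0) \<and>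
      (\<forall>b\<in>B. (\<Sum>k\<in>{..?D}. p k * c k b) = 0)"
    by (rule homogeneous_dependence[of ?G])
      (use B(1) c(1) in \<open>auto intro: form_zero form_one form_diff form_mult dest: form_no_zero_divisors\<close>)
  then obtain p E where p: "\<forall>k\<in>{..?D}. p k \<noteq> 0 \<longrightarrow> (\<exists>q. p k \<in> ?G q \<and> q + e * k = E)"
      "\<exists>k\<in>{..?D}. p k \<noteq> 0" and dep: "\<forall>b\<in>B. (\<Sum>k\<in>{..?D}. p k * c k b) = 0"
    by (elim exE conjE)
  have deg: "p k \<noteq> 0 \<longrightarrow> e * k \<le> E \<and> form U (E - e * k) (p k)" if "k \<le> ?D" for k
    using p(1) that by fastforce
  let ?r = "\<Sum>k\<le>?D. p k * f ^ k"
  have "?r x * s0 x = 0" if x: "x \<in> C" for x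
  proof -
    have "?r x * s0 x = (\<Sum>k\<le>?D. p k x * (s0 * f ^ k) x)"
      by (simp add: pointwise sum_distrib_left sum_distrib_right mult_ac)
    also have "\<dots> = (\<Sum>k\<le>?D. p k x * (\<Sum>b\<in>B. c k b x * b x))"
      using c(2) x by (intro sum.cong) simp_all
    also have "\<dots> = (\<Sum>b\<in>B. (\<Sum>k\<le>?D. p k * c k b) x * b x)"
      unfolding sum_distrib_left pointwise sum_distrib_right by (subst sum.swap) (simp add: mult_ac)
    also have "\<dots> = 0" using dep by (simp add: pointwise)
    finally show ?thesis .
  qed
  moreover have "form {0} E ?r"
    using f by (intro form_sum relation_term_form[where U = U and e = e] deg) (auto simp: acts_def)
  ultimately have "\<forall>x\<in>C. ?r x = 0"
    using prime[OF _ s0(1), of E ?r] s0 by blast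
  then have "algebraic_relation U e f E ?D p"
    unfolding algebraic_relation_def using deg p(2) by (auto simp: pointwise)
  then show thesis by (rule that)
qed

text \<open>
  A nonzero element of the coordinate ring divides a nonzero form \<open>\<alpha>\<close> on the target of the projection:
  cancel a power of \<open>f\<close> from an algebraic relation, so that the constant term becomes nonzero, and take
  this term for \<open>\<alpha>\<close>. The cofactor \<open>r\<close> is a polynomial in \<open>f\<close> over the target, so it acts as well. When
  \<open>r = 0\<close> the degrees are unrelated; then \<open>\<alpha>\<close> vanishes on \<open>C\<close>.
\<close>

lemma norm_exists:
  assumes f: "acts U N e f" and nz: "\<exists>x\<in>C. f x \<noteq> 0"
  obtains d \<alpha> e' r where "form U d \<alpha>" "\<alpha> \<noteq> 0" "acts U N e' r" "r \<noteq> 0 \<longrightarrow> d = e + e'"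
    "\<forall>x\<in>C. \<alpha> x = f x * r x"
proof -
  obtain E D p where "algebraic_relation U e f E D p" using acting_imp_relation[OF f] .
  then have deg: "\<And>k. k \<le> D \<Longrightarrow> p k \<noteq> 0 \<Longrightarrow> e * k \<le> E \<and> form U (E - e * k) (p k)"
    and ex: "\<exists>k. k \<le> D \<and> p k \<noteq> 0" and rel: "\<And>x. x \<in> C \<Longrightarrow> (\<Sum>k\<le>D. p k x * f x ^ k) = 0"
    unfolding algebraic_relation_def by blast+
  have ff: "form {0} e f" using f by (simp add: acts_def)
  define k0 where "k0 = (LEAST k. k \<le> D \<and> p k \<noteq> 0)"
  have k0: "k0 \<le> D" "p k0 \<noteq> 0" using LeastI_ex[OF ex] by (auto simp: k0_def)
  have below: "p k = 0" if "k < k0" for k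
    using not_less_Least[of k "\<lambda>k. k \<le> D \<and> p k \<noteq> 0"] that k0(1) unfolding k0_def[symmetric] by auto
  define r where "r = - (\<Sum>k\<in>{k0<..D}. p k * f ^ (k - k0 - 1))"
  define e' where "e' = (if r = 0 then 0 else E - e * k0 - e)"
  have step: "e * k0 + e \<le> e * k" if "k0 < k" for k
    using mult_le_mono2[of "Suc k0" k e] that by simp
  have deg_eq: "E - e * k0 = e + e'" if "r \<noteq> 0"
  proof -
    have "\<exists>k\<in>{k0<..D}. p k \<noteq> 0"
    proof (rule ccontr)
      assume "\<not> ?thesis"
      then have "(\<Sum>k\<in>{k0<..D}. p k * f ^ (k - k0 - 1)) = 0" by (intro sum.neutral) auto
      then show False using that by (simp add: r_def)
    qed
    then obtain k where "k0 < k" "k \<le> D" "p k \<noteq> 0" by auto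
    then have "e * k0 + e \<le> E" using deg step[of k] by force
    then show ?thesis using that by (simp add: e'_def)
  qed
  have "acts U N e' r"
  proof (cases "r = 0")
    case True
    then show ?thesis by (simp add: acts_form form_zero)
  next
    case False
    have "acts U N e' (- (p k * f ^ (k - k0 - 1)))" if k: "k \<in> {k0<..D}" for k
    proof (cases "p k = 0")
      case True
      then show ?thesis by (simp add: acts_form form_zero)
    next
      case False
      have le: "e * k \<le> E" and fm: "form U (E - e * k) (p k)" using deg[OF _ False] k by auto
      have "form U (E - e * k) (- p k)" using form_diff[OF form_zero fm] by simp
      then have "acts U N ((E - e * k) + e * (k - k0 - 1)) (- p k * f ^ (k - k0 - 1))"
        by (intro acts_mult acts_form acts_power f)
      moreover have "(E - e * k) + e * (k - k0 - 1) = e'"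
      proof -
        have "e * (k - k0 - 1) = e * k - e * k0 - e" by (simp add: diff_mult_distrib2)
        then show ?thesis using le step[of k] k \<open>r \<noteq> 0\<close> by (simp add: e'_def)
      qed
      ultimately show ?thesis by simp
    qed
    then have "acts U N e' (\<Sum>k\<in>{k0<..D}. - (p k * f ^ (k - k0 - 1)))" by (rule acts_sum)
    then show ?thesis by (simp add: r_def sum_negf)
  qed
  moreover have "\<forall>x\<in>C. p k0 x = f x * r x"
  proof -
    let ?g = "\<Sum>k\<in>{k0..D}. p k * f ^ (k - k0)"
    have split: "(\<Sum>k\<le>D. p k * f ^ k) = f ^ k0 * ?g"
    proof -
      have "(\<Sum>k\<le>D. p k * f ^ k) = (\<Sum>k\<in>{k0..D}. p k * f ^ k)"
        using below by (intro sum.mono_neutral_right) (auto simp: not_le)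
      also have "\<dots> = (\<Sum>k\<in>{k0..D}. f ^ k0 * (p k * f ^ (k - k0)))"
        by (intro sum.cong refl) (simp add: mult.left_commute[of "f ^ k0"] power_add[symmetric])
      finally show ?thesis by (simp add: sum_distrib_left)
    qed
    have g: "?g = p k0 - f * r"
    proof -
      have "{k0..D} = insert k0 {k0<..D}" using k0(1) by auto
      then have "?g = p k0 + (\<Sum>k\<in>{k0<..D}. p k * f ^ (k - k0))" by simp
      also have "(\<Sum>k\<in>{k0<..D}. p k * f ^ (k - k0)) = (\<Sum>k\<in>{k0<..D}. f * (p k * f ^ (k - k0 - 1)))"
      proof (intro sum.cong refl)
        fix k assume "k \<in> {k0<..D}"
        then have "k0 < k" by simp
        then have "k - k0 = Suc (k - k0 - 1)" by arith
        then show "p k * f ^ (k - k0) = f * (p k * f ^ (k - k0 - 1))" by (metis mult.left_commute power_Suc)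
      qed
      finally show ?thesis by (simp add: r_def sum_distrib_left)
    qed
    have "form {0} (E - e * k0) ?g"
    proof (rule form_sum)
      fix k assume k: "k \<in> {k0..D}"
      show "form {0} (E - e * k0) (p k * f ^ (k - k0))"
      proof (rule relation_term_form[OF ff, where U = U], rule impI)
        assume "p k \<noteq> 0"
        then have "e * k \<le> E" "form U (E - e * k) (p k)" using deg k by auto
        then show "e * (k - k0) \<le> E - e * k0 \<and> form U (E - e * k0 - e * (k - k0)) (p k)"
          using k mult_le_mono2[of k0 k e] by (auto simp: diff_mult_distrib2)
      qed
    qed
    moreover have "\<forall>x\<in>C. (f ^ k0) x * ?g x = 0"
      using rel split by (metis (no_types, lifting) pointwise(3) pointwise(7) pointwise(8) sum.cong)
    ultimately have "(\<forall>x\<in>C. (f ^ k0) x = 0) \<or> (\<forall>x\<in>C. ?g x = 0)"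
      using prime[OF form_power[OF ff]] by blast
    moreover have "\<not> (\<forall>x\<in>C. (f ^ k0) x = 0)" using nz by (auto simp: pointwise)
    ultimately have "\<forall>x\<in>C. ?g x = 0" by blast
    then show ?thesis unfolding g by (simp add: pointwise)
  qed
  moreover have "form U (E - e * k0) (p k0)" using deg k0 by blast
  ultimately show thesis using that k0(2) deg_eq by blast
qed

end

section \<open>Order of vanishing at a point\<close>

context irreducible_cone begin

lemma prod_nonvanishing:
  assumes "finite A" "\<And>i. i \<in> A \<Longrightarrow> form {0} (d i) (f i)" "\<And>i. i \<in> A \<Longrightarrow> \<exists>x\<in>C. f i x \<noteq> 0"
  shows "\<exists>x\<in>C. prod f A x \<noteq> 0"
  using assms
proof (induction A rule: finite_induct)
  case empty
  then show ?case using nontrivial by (auto simp: pointwise)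
next
  case (insert i A)
  have "\<not> (\<forall>x\<in>C. f i x = 0)" "\<not> (\<forall>x\<in>C. prod f A x = 0)" using insert by auto
  moreover have "form {0} (sum d A) (prod f A)" using insert by (intro form_prod) auto
  moreover have "form {0} (d i) (f i)" using insert by auto
  ultimately have "\<not> (\<forall>x\<in>C. f i x * prod f A x = 0)"
    using prime by blast
  then show ?case using insert.hyps by (auto simp: pointwise)
qed

text \<open>
  Membership of \<open>f\<close> in the \<open>e\<close>-th power of the ideal of \<open>U\<close> after localising the coordinate ring of \<open>C\<close> at
  \<open>q\<close>: a form not vanishing at \<open>q\<close> is allowed as denominator.
\<close>

definition order_at :: "'k ^ 'n \<Rightarrow> ('k ^ 'n) set \<Rightarrow> nat \<Rightarrow> nat \<Rightarrow> ('k ^ 'n \<Rightarrow> 'k) \<Rightarrow> bool" where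
  "order_at q U e d f \<longleftrightarrow> (\<exists>n s. form {0} n s \<and> s q \<noteq> 0 \<and> ideal_power C U e (n + d) (s * f))"

lemma order_at_ideal_power: "ideal_power C U e d f \<Longrightarrow> order_at q U e d f"
  unfolding order_at_def using form_one by (intro exI[of _ 0] exI[of _ 1]) (auto simp: one_fun_apply)

lemma order_at_cong:
  assumes "order_at q U e d f" "\<And>x. x \<in> C \<Longrightarrow> f x = f' x" shows "order_at q U e d f'"
proof -
  obtain n s where s: "form {0} n s" "s q \<noteq> 0" "ideal_power C U e (n + d) (s * f)"
    using assms(1) unfolding order_at_def by blast
  then have "ideal_power C U e (n + d) (s * f')"
    by (elim ideal_power_cong) (simp add: times_fun_apply assms(2))
  then show ?thesis using s(1,2) unfolding order_at_def by blast
qed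

lemma order_at_times:
  assumes "order_at q U e d f" "order_at q U e' d' f'"
  shows "order_at q U (e + e') (d + d') (f * f')"
proof -
  obtain n s n' s' where s: "form {0} n s" "s q \<noteq> 0" "ideal_power C U e (n + d) (s * f)"
    "form {0} n' s'" "s' q \<noteq> 0" "ideal_power C U e' (n' + d') (s' * f')"
    using assms unfolding order_at_def by blast
  have "form {0} (n + n') (s * s')" "(s * s') q \<noteq> 0"
    using s form_mult by (auto simp: times_fun_apply)
  moreover have "ideal_power C U (e + e') (n + n' + (d + d')) (s * s' * (f * f'))"
    using ideal_power_times[OF s(3,6)] by (simp add: mult_ac add_ac)
  ultimately show ?thesis unfolding order_at_def by blast
qed

lemma order_at_form: "form {0} d f \<Longrightarrow> order_at q U 0 d f"
  using order_at_ideal_power ideal_power_product[OF form_one, of d f d C U] by force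

lemma order_at_mult_form:
  "order_at q U e d f \<Longrightarrow> form {0} d' g \<Longrightarrow> order_at q U e (d + d') (g * f)"
  using order_at_times[OF _ order_at_form, of q U e d f d' g] by (simp add: mult.commute)

lemma order_at_add:
  assumes "order_at q U e d f" "order_at q U e d f'" shows "order_at q U e d (f + f')"
proof -
  obtain n s n' s' where s: "form {0} n s" "s q \<noteq> 0" "ideal_power C U e (n + d) (s * f)"
    "form {0} n' s'" "s' q \<noteq> 0" "ideal_power C U e (n' + d) (s' * f')"
    using assms unfolding order_at_def by blast
  have "form {0} (n + n') (s * s')" "(s * s') q \<noteq> 0"
    using s form_mult by (auto simp: times_fun_apply)
  moreover have "ideal_power C U e (n + n' + d) (s' * (s * f))" "ideal_power C U e (n + n' + d) (s * (s' * f'))"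
    using ideal_power_mult_form[OF s(3,4)] ideal_power_mult_form[OF s(6,1)] by (simp_all add: add_ac)
  then have "ideal_power C U e (n + n' + d) (s * s' * (f + f'))"
    using ideal_power_add[of C U e "n + n' + d" "s' * (s * f)" "s * (s' * f')"] by (simp add: algebra_simps)
  ultimately show ?thesis unfolding order_at_def by blast
qed

lemma order_at_zero: "(\<And>x. x \<in> C \<Longrightarrow> f x = 0) \<Longrightarrow> order_at q U e d f"
  by (rule order_at_ideal_power) (rule ideal_power_zero)

lemma order_at_scale: "order_at q U e d f \<Longrightarrow> order_at q U e d ((\<lambda>_. c) * f)"
  using order_at_mult_form[OF _ form_const] by force

lemma order_at_sum:
  "(\<And>i. i \<in> A \<Longrightarrow> order_at q U e d (f i)) \<Longrightarrow> order_at q U e d (sum f A)"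
  by (induction A rule: infinite_finite_induct) (auto intro: order_at_add order_at_zero simp: zero_fun_apply)

lemma order_at_prod:
  assumes "finite A" "\<And>i. i \<in> A \<Longrightarrow> order_at q U (e i) (d i) (f i)"
  shows "order_at q U (sum e A) (sum d A) (prod f A)"
  using assms
  by (induction A rule: finite_induct) (auto intro: order_at_times order_at_form form_one)

lemma order_at_cancel:
  assumes "order_at q U e (n + d) (s * f)" "form {0} n s" "s q \<noteq> 0"
  shows "order_at q U e d f"
proof -
  obtain n' s' where s': "form {0} n' s'" "s' q \<noteq> 0" "ideal_power C U e (n' + (n + d)) (s' * (s * f))"
    using assms(1) unfolding order_at_def by blast
  then show ?thesis
    unfolding order_at_def using form_mult[OF s'(1) assms(2)] assms(3)
    by (intro exI[of _ "n' + n"] exI[of _ "s' * s"]) (auto simp: times_fun_apply add_ac mult_ac)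
qed

end

section \<open>Unramified points of the projection from a maximal centre\<close>

text \<open>
  A centre \<open>W\<close> for which the projection of \<open>C\<close> is finite and dominant. A subspace that is maximal
  among those that meet \<open>C\<close> only in \<open>0\<close> has these properties.
\<close>

locale maximal_center = irreducible_cone C
  for C :: "('k :: {alg_closed_field, field_char_0} ^ 'n :: finite) set" +
  fixes W :: "('k ^ 'n) set"
  assumes subspace: "vec.subspace W" and disjoint: "C \<inter> W \<subseteq> {0}"
    and dominant: "\<And>d f. form W d f \<Longrightarrow> f \<noteq> 0 \<Longrightarrow> \<exists>x\<in>C. f x \<noteq> 0"
begin

text \<open>
  The derivative of the polynomial \<open>\<Sum>k\<le>D. p k * T ^ k\<close> at \<open>T = f\<close>. The term for \<open>k = 0\<close> is zero although
  the exponent \<open>0 - 1\<close> is truncated.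
\<close>

definition derivative where
  "derivative p D f = (\<Sum>k\<le>D. (\<lambda>_. of_nat k) * (p k * f ^ (k - 1)))"
  for p :: "nat \<Rightarrow> 'k ^ 'n \<Rightarrow> 'k" and f :: "'k ^ 'n \<Rightarrow> 'k"

lemma form_derivative:
  assumes f: "form {0} e f" and rel: "algebraic_relation W e f E D p"
  shows "form {0} (E - e) (derivative p D f)"
  unfolding derivative_def
proof (rule form_sum)
  fix k assume k: "k \<in> {..D}"
  show "form {0} (E - e) ((\<lambda>_. of_nat k) * (p k * f ^ (k - 1)))"
  proof (cases k)
    case 0
    have "(\<lambda>_. of_nat 0) * (p k * f ^ (k - 1)) = (0 :: 'k ^ 'n \<Rightarrow> 'k)"
      by (rule ext) (simp add: pointwise)
    then show ?thesis using 0 form_zero by metis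
  next
    case (Suc j)
    have "form {0} (E - e) (p k * f ^ j)"
    proof (rule relation_term_form[OF f, where U = W], rule impI)
      assume "p k \<noteq> 0"
      then show "e * j \<le> E - e \<and> form W (E - e - e * j) (p k)"
        using rel k Suc by (auto simp: algebraic_relation_def)
    qed
    then show ?thesis using Suc by (simp add: form_scale)
  qed
qed

text \<open>
  In characteristic zero the derivative of a relation of minimal degree is not identically zero on \<open>C\<close>, as it
  would otherwise be a relation of smaller degree. The remaining case, a relation that consists of its constant
  term, contradicts dominance.
\<close>

lemma separable_relation:
  assumes f: "acts W N e f"
  obtains E D p where "algebraic_relation W e f E D p" "\<exists>x\<in>C. derivative p D f x \<noteq> 0"
proof -
  let ?P = "\<lambda>D. \<exists>E p. algebraic_relation W e f E D p"
  have ex: "\<exists>D. ?P D" using acting_imp_relation[OF f] by metis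
  define D where "D = (LEAST D. ?P D)"
  obtain E p where rel: "algebraic_relation W e f E D p"
    using LeastI_ex[OF ex] unfolding D_def by blast
  have minimal: "\<not> algebraic_relation W e f E' D' p'" if "D' < D" for D' E' p'
    using not_less_Least that unfolding D_def by blast
  note deg = rel[unfolded algebraic_relation_def, THEN conjunct1, rule_format]
  note van = rel[unfolded algebraic_relation_def, THEN conjunct2, THEN conjunct2, rule_format]
  have "\<exists>x\<in>C. derivative p D f x \<noteq> 0"
  proof (rule ccontr)
    assume "\<not> ?thesis"
    then have zero: "(\<Sum>k\<le>D. of_nat k * (p k x * f x ^ (k - 1))) = 0" if "x \<in> C" for x
      using that by (simp add: derivative_def pointwise)
    obtain k where k: "k \<le> D" "p k \<noteq> 0" using rel by (auto simp: algebraic_relation_def)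
    show False
    proof (cases "\<exists>k\<in>{1..D}. p k \<noteq> 0")
      case False
      then have "k = 0" using k by (cases k) auto
      then have "form W E (p 0)" "p 0 \<noteq> 0" using deg[OF k] k(2) by auto
      then obtain x where x: "x \<in> C" "p 0 x \<noteq> 0" using dominant by blast
      have "(\<Sum>k\<le>D. p k x * f x ^ k) = (\<Sum>k\<in>{0}. p k x * f x ^ k)"
        using False by (intro sum.mono_neutral_right) (auto simp: Ball_def zero_fun_apply Suc_le_eq)
      then show False using van[OF x(1)] x(2) by simp
    next
      case True
      then obtain k where k: "1 \<le> k" "k \<le> D" "p k \<noteq> 0" by auto
      then obtain D' where D': "D = Suc D'" by (cases D) auto
      define p' where "p' j = (\<lambda>_. of_nat (Suc j)) * p (Suc j)" for j
      have p'_zero: "p' j = 0 \<longleftrightarrow> p (Suc j) = 0" for j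
        unfolding p'_def fun_eq_iff by (simp add: pointwise del: of_nat_Suc)
      have "algebraic_relation W e f (E - e) D' p'"
        unfolding algebraic_relation_def
      proof (intro conjI allI impI ballI)
        fix j assume j: "j \<le> D'" "p' j \<noteq> 0"
        then have "e * Suc j \<le> E \<and> form W (E - e * Suc j) (p (Suc j))"
          using deg[of "Suc j"] D' p'_zero by auto
        then show "e * j \<le> E - e" "form W (E - e - e * j) (p' j)"
          by (auto simp: p'_def intro!: form_scale)
      next
        show "\<exists>j\<le>D'. p' j \<noteq> 0"
          using k D' by (intro exI[of _ "k - 1"]) (auto simp: p'_zero)
      next
        fix x assume "x \<in> C"
        then have "0 = (\<Sum>k\<le>Suc D'. of_nat k * (p k x * f x ^ (k - 1)))" using zero D' by simp
        also have "\<dots> = (\<Sum>j\<le>D'. p' j x * f x ^ j)"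
          by (subst sum.atMost_Suc_shift) (simp add: p'_def times_fun_apply mult.assoc del: of_nat_Suc)
        finally show "(\<Sum>j\<le>D'. p' j x * f x ^ j) = 0" by simp
      qed
      then show False using minimal D' by blast
    qed
  qed
  with rel show thesis by (rule that)
qed

text \<open>
  At each point of \<open>C\<close> above \<open>a\<close> every coordinate is a simple root of an equation over the target of the
  projection. Points above \<open>a\<close> are normalised to the affine subspace \<open>a + W\<close>.
\<close>

definition unramified_point :: "'k ^ 'n \<Rightarrow> bool" where
  "unramified_point a \<longleftrightarrow> (\<forall>i. \<exists>E D p. algebraic_relation W 1 (dot (axis i 1)) E D p \<and>
     (\<forall>w\<in>W. a + w \<in> C \<longrightarrow> derivative p D (dot (axis i 1)) (a + w) \<noteq> 0))"

text \<open>
  The product of the derivatives for all coordinates divides a nonzero form \<open>\<alpha>\<close> on the target, and any \<open>a\<close>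
  outside its zero set will do. A second factor \<open>dot c\<close> keeps \<open>a\<close> away from \<open>W\<close>.
\<close>

lemma unramified_point_exists: obtains a where "a \<notin> W" "unramified_point a"
proof -
  obtain N where N: "\<And>e f. form {0} e f \<Longrightarrow> acts W N e f"
    using all_forms_act[OF subspace disjoint] by blast
  let ?x = "\<lambda>i. dot (axis i 1) :: 'k ^ 'n \<Rightarrow> 'k"
  have x: "form {0} 1 (?x i)" for i by (intro form_linear) simp
  define separable where "separable i E D p \<longleftrightarrow> algebraic_relation W 1 (?x i) E D p \<and>
    (\<exists>x\<in>C. derivative p D (?x i) x \<noteq> 0)" for i E D p
  have "\<exists>E D p. separable i E D p" for i
  proof -
    obtain E D p where "algebraic_relation W 1 (?x i) E D p" "\<exists>x\<in>C. derivative p D (?x i) x \<noteq> 0"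
      using separable_relation[OF N[OF x]] .
    then show ?thesis unfolding separable_def by (intro exI conjI)
  qed
  then obtain E D p where "\<And>i. separable i (E i) (D i) (p i)" by metis
  then have rel: "\<And>i. algebraic_relation W 1 (?x i) (E i) (D i) (p i)"
    and nz: "\<And>i. \<exists>x\<in>C. derivative (p i) (D i) (?x i) x \<noteq> 0" unfolding separable_def by blast+
  let ?\<delta> = "\<lambda>i. derivative (p i) (D i) (?x i)"
  have fd: "form {0} (E i - 1) (?\<delta> i)" for i using form_derivative[OF x rel] .
  have nz': "\<exists>x\<in>C. prod ?\<delta> UNIV x \<noteq> 0" using fd nz by (intro prod_nonvanishing) auto
  have "form {0} (\<Sum>i\<in>UNIV. E i - 1) (prod ?\<delta> UNIV)" using fd by (intro form_prod) auto
  from norm_exists[OF N[OF this] nz']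
  obtain d \<alpha> e' r where \<alpha>: "form W d \<alpha>" "\<alpha> \<noteq> 0"
    and "acts W N e' r" "r \<noteq> 0 \<longrightarrow> d = (\<Sum>i\<in>UNIV. E i - 1) + e'"
    and \<alpha>_eq: "\<forall>x\<in>C. \<alpha> x = prod ?\<delta> UNIV x * r x" .
  obtain x where "x \<in> C" "x \<noteq> 0" using nontrivial by blast
  then have "x \<notin> W" using disjoint by blast
  then obtain c where c: "c \<in> annihilator W" "dot c x = 1" using separating_functional[OF subspace] by blast
  have "dot c \<noteq> 0" using c(2) by (auto simp: zero_fun_apply)
  then have "\<alpha> * dot c \<noteq> 0" using form_no_zero_divisors[OF \<alpha>(1) form_linear[OF c(1)]] \<alpha>(2) by blast
  then obtain a where a: "\<alpha> a \<noteq> 0" "dot c a \<noteq> 0" by (auto simp: fun_eq_iff pointwise)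
  have "a \<notin> W" using c(1) a(2) annihilatorD by blast
  moreover have "unramified_point a"
    unfolding unramified_point_def
  proof (intro allI exI conjI ballI impI)
    fix i show "algebraic_relation W 1 (?x i) (E i) (D i) (p i)" by (rule rel)
    fix w assume w: "w \<in> W" "a + w \<in> C"
    have "\<alpha> (a + w) \<noteq> 0" using form_invariant[OF \<alpha>(1) w(1)] a(1) by simp
    then have "prod ?\<delta> UNIV (a + w) \<noteq> 0" using \<alpha>_eq w(2) by auto
    then show "?\<delta> i (a + w) \<noteq> 0" by (simp add: prod_fun_apply)
  qed
  ultimately show thesis by (rule that)
qed

end

section \<open>The linear section through an unramified point\<close>

text \<open>
  The linear form \<open>dot c0\<close> serves as the coordinate on the line spanned by \<open>a\<close>: together with the linear
  forms vanishing on the section \<open>M\<close> spanned by \<open>W\<close> and \<open>a\<close> it spans the linear forms vanishing on \<open>W\<close>.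
\<close>

locale unramified_section = maximal_center C W
  for C W :: "('k :: {alg_closed_field, field_char_0} ^ 'n :: finite) set" +
  fixes a c0 :: "'k ^ 'n"
  assumes unramified: "unramified_point a" and c0: "c0 \<in> annihilator W" "dot c0 a = 1"
begin

definition M :: "('k ^ 'n) set" where "M = vec.span (insert a W)"

text \<open>
  Representatives of the points of \<open>C \<inter> M\<close>, normalised by \<open>dot c0 q = 1\<close>.
\<close>

definition fiber :: "('k ^ 'n) set" where "fiber = {q \<in> C. \<exists>w\<in>W. q = a + w}"

lemma M_subspace: "vec.subspace M"
  by (simp add: M_def vec.subspace_span)

lemma mem_M_iff: "x \<in> M \<longleftrightarrow> (\<exists>t. x - t *s a \<in> W)"
  using subspace by (simp add: M_def vec.span_breakdown_eq vec.span_eq_iff[THEN iffD2])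

lemma W_subset_M: "W \<subseteq> M"
  unfolding M_def using vec.span_superset by blast

lemma a_mem_M: "a \<in> M"
  unfolding M_def using vec.span_base by blast

lemma annihilator_M_iff: "c \<in> annihilator M \<longleftrightarrow> c \<in> annihilator W \<and> dot c a = 0"
proof
  assume "c \<in> annihilator M"
  then show "c \<in> annihilator W \<and> dot c a = 0"
    using W_subset_M a_mem_M by (auto simp: annihilator_def)
next
  assume c: "c \<in> annihilator W \<and> dot c a = 0"
  have "dot c x = 0" if "x \<in> M" for x
  proof -
    obtain t where "x - t *s a \<in> W" using \<open>x \<in> M\<close> mem_M_iff by blast
    then have "dot c (x - t *s a) = 0" using c annihilatorD by blast
    then show ?thesis using c by simp
  qed
  then show "c \<in> annihilator M" by (simp add: annihilator_def)
qed

lemma fiberD: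
  assumes "q \<in> fiber"
  shows "q \<in> C" "q \<in> M" "dot c0 q = 1" "form W d f \<Longrightarrow> f q = f a"
proof -
  obtain w where w: "w \<in> W" "q = a + w" "q \<in> C" using assms unfolding fiber_def by blast
  show "q \<in> C" by (rule w(3))
  show "q \<in> M" unfolding mem_M_iff using w by (intro exI[of _ 1]) simp
  show "dot c0 q = 1" using w c0 annihilatorD by simp
  show "f q = f a" if "form W d f" using form_invariant[OF that w(1)] w(2) by simp
qed

lemma form_W_modulo_M:
  assumes "form W d f"
  shows "ideal_power C M 1 d (f - (\<lambda>_. f a) * dot c0 ^ d)"
  using assms
proof (induction rule: form.induct)
  case (form_add d f g)
  have "(f + g) - (\<lambda>_. (f + g) a) * dot c0 ^ d = (f - (\<lambda>_. f a) * dot c0 ^ d) + (g - (\<lambda>_. g a) * dot c0 ^ d)"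
    by (auto simp: fun_eq_iff pointwise algebra_simps)
  then show ?case using ideal_power_add[OF form_add.IH] by metis
next
  case (form_dot c d f)
  let ?c = "c - dot c a *s c0"
  have "?c \<in> annihilator M" unfolding annihilator_M_iff using form_dot.hyps c0 by simp
  then have "form M 1 (dot ?c)" by (rule form_linear)
  moreover have "form {0} d (dot c0 ^ d)" using form_power[OF form_linear, of c0 "{0}" d] by simp
  ultimately have "ideal_power C M 1 (Suc d) (dot ?c * ((\<lambda>_. f a) * dot c0 ^ d))"
    using form_scale by (intro ideal_power_product[where n = d]) auto
  moreover have "ideal_power C M 1 (d + 1) (dot c * (f - (\<lambda>_. f a) * dot c0 ^ d))"
    by (intro ideal_power_mult_form form_dot.IH form_linear) simp
  ultimately have "ideal_power C M 1 (Suc d)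
      (dot c * (f - (\<lambda>_. f a) * dot c0 ^ d) + dot ?c * ((\<lambda>_. f a) * dot c0 ^ d))"
    using ideal_power_add by simp
  then show ?case by (rule ideal_power_cong) (auto simp: pointwise algebra_simps)
qed (auto intro!: ideal_power_zero simp: pointwise)

text \<open>
  Reduce the equation of the coordinate \<open>f\<close> modulo the ideal of \<open>M\<close>: its coefficients \<open>p k\<close> turn into
  \<open>p k a\<close> times a power of \<open>x = dot c0\<close>, and the equation into a binary form in \<open>f\<close> and \<open>x\<close>. It has the
  simple zero \<open>f = \<eta> * x\<close> at \<open>q\<close>, so it factors as \<open>(f - \<eta> * x) * s\<close> where \<open>s q\<close> is the derivative.
\<close>

lemma coordinate_unramified:
  assumes q: "q \<in> fiber"
  shows "order_at q M 1 1 (dot (axis i 1) - (\<lambda>_. q $ i) * dot c0)"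
proof -
  let ?f = "dot (axis i 1) :: 'k ^ 'n \<Rightarrow> 'k" and ?x = "dot c0" and ?\<eta> = "q $ i"
  obtain E D p where rel: "algebraic_relation W 1 ?f E D p"
    and der: "\<forall>w\<in>W. a + w \<in> C \<longrightarrow> derivative p D ?f (a + w) \<noteq> 0"
    using unramified unfolding unramified_point_def by blast
  have der_q: "derivative p D ?f q \<noteq> 0" using der q by (auto simp: fiber_def)
  have deg: "k \<le> E" "form W (E - k) (p k)" if "k \<le> D" "p k \<noteq> 0" for k
    using rel that by (auto simp: algebraic_relation_def)
  have van: "(\<Sum>k\<le>D. p k x * ?f x ^ k) = 0" if "x \<in> C" for x
    using rel that unfolding algebraic_relation_def by blast
  have pq: "p k q = p k a" if "k \<le> D" for k
    using fiberD(4)[OF q deg(2)[OF that]] by (cases "p k = 0") (auto simp: zero_fun_apply)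
  have ff: "form {0} 1 ?f" and fx: "form {0} 1 ?x" by (intro form_linear; simp)+
  define B where "B = (\<Sum>k\<le>D. (\<lambda>_. p k a) * (?x ^ (E - k) * ?f ^ k))"
  define s where "s = (\<Sum>k\<le>D. (\<lambda>_. p k a) * (?x ^ (E - k) *
    (\<Sum>j<k. ((\<lambda>_. ?\<eta>) * ?x) ^ (k - Suc j) * ?f ^ j)))"
  have "ideal_power C M 1 E (\<Sum>k\<le>D. ?f ^ k * (p k - (\<lambda>_. p k a) * ?x ^ (E - k)))"
  proof (rule ideal_power_sum)
    fix k assume k: "k \<in> {..D}"
    show "ideal_power C M 1 E (?f ^ k * (p k - (\<lambda>_. p k a) * ?x ^ (E - k)))"
    proof (cases "p k = 0")
      case True
      then show ?thesis by (intro ideal_power_zero) (simp add: pointwise)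
    next
      case False
      then have "form W (E - k) (p k)" "k \<le> E" using deg k by auto
      then show ?thesis
        using ideal_power_mult_form[OF form_W_modulo_M form_power[OF ff, of k]] by fastforce
    qed
  qed
  then have "ideal_power C M 1 E ((\<lambda>_. -1) * (\<Sum>k\<le>D. ?f ^ k * (p k - (\<lambda>_. p k a) * ?x ^ (E - k))))"
    using ideal_power_mult_form[OF _ form_const[of "{0}" "-1"]] by force
  then have B: "ideal_power C M 1 E B"
  proof (rule ideal_power_cong)
    fix x assume "x \<in> C"
    have "(\<Sum>k\<le>D. p k x * ?f x ^ k) - B x
        = (\<Sum>k\<le>D. ?f ^ k * (p k - (\<lambda>_. p k a) * ?x ^ (E - k))) x"
      by (simp add: B_def pointwise sum_subtractf[symmetric] algebra_simps)
    then show "((\<lambda>_. -1) * (\<Sum>k\<le>D. ?f ^ k * (p k - (\<lambda>_. p k a) * ?x ^ (E - k)))) x = B x"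
      using van[OF \<open>x \<in> C\<close>] by (simp only: times_fun_apply) (metis diff_0 minus_minus mult_minus1)
  qed
  have root: "(\<Sum>k\<le>D. p k a * ?\<eta> ^ k) = 0"
    using van[OF fiberD(1)[OF q]] pq by simp
  have B_eq: "B = s * (?f - (\<lambda>_. ?\<eta>) * ?x)"
  proof
    fix y
    have term_eq: "p k a * (?x y ^ (E - k) * ?f y ^ k) = p k a * ?\<eta> ^ k * ?x y ^ E +
      p k a * (?x y ^ (E - k) * ((?f y - ?\<eta> * ?x y) * (\<Sum>j<k. (?\<eta> * ?x y) ^ (k - Suc j) * ?f y ^ j)))"
      if "k \<le> D" for k
    proof (cases "p k = 0")
      case False
      then have "?x y ^ E = ?x y ^ (E - k) * ?x y ^ k"
        using deg(1)[OF that] by (simp flip: power_add)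
      then show ?thesis
        unfolding power_diff_sumr2[symmetric] by (simp add: algebra_simps power_mult_distrib)
    qed (simp add: zero_fun_apply)
    have "B y = (\<Sum>k\<le>D. p k a * (?x y ^ (E - k) * ?f y ^ k))"
      by (simp add: B_def pointwise)
    also have "\<dots> = (\<Sum>k\<le>D. p k a * ?\<eta> ^ k * ?x y ^ E +
      p k a * (?x y ^ (E - k) * ((?f y - ?\<eta> * ?x y) * (\<Sum>j<k. (?\<eta> * ?x y) ^ (k - Suc j) * ?f y ^ j))))"
      using term_eq by (intro sum.cong) auto
    also have "\<dots> = (\<Sum>k\<le>D. p k a * ?\<eta> ^ k) * ?x y ^ E + (\<Sum>k\<le>D.
      p k a * (?x y ^ (E - k) * (\<Sum>j<k. (?\<eta> * ?x y) ^ (k - Suc j) * ?f y ^ j))) * (?f y - ?\<eta> * ?x y)"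
      by (simp only: sum.distrib sum_distrib_left sum_distrib_right mult_ac)
    finally show "B y = (s * (?f - (\<lambda>_. ?\<eta>) * ?x)) y"
      unfolding root by (simp add: s_def pointwise)
  qed
  have s_q: "s q = derivative p D ?f q"
  proof -
    have "s q = (\<Sum>k\<le>D. p k q * (\<Sum>j<k. ?\<eta> ^ (k - Suc j) * ?\<eta> ^ j))"
      using pq fiberD(3)[OF q] by (simp add: s_def pointwise)
    also have "\<dots> = (\<Sum>k\<le>D. of_nat k * (p k q * ?\<eta> ^ (k - 1)))"
    proof (intro sum.cong refl)
      fix k
      have "(\<Sum>j<k. ?\<eta> ^ (k - Suc j) * ?\<eta> ^ j) = (\<Sum>j<k. ?\<eta> ^ (k - 1))"
        by (intro sum.cong refl) (simp flip: power_add)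
      then show "p k q * (\<Sum>j<k. ?\<eta> ^ (k - Suc j) * ?\<eta> ^ j) = of_nat k * (p k q * ?\<eta> ^ (k - 1))"
        by simp
    qed
    finally show ?thesis by (simp add: derivative_def pointwise)
  qed
  have E: "1 \<le> E"
  proof (rule ccontr)
    assume "\<not> 1 \<le> E"
    then have "of_nat k * (p k q * ?f q ^ (k - 1)) = 0" if "k \<le> D" for k
      using deg(1)[OF that] by (cases "p k = 0") (auto simp: zero_fun_apply)
    then have "(\<Sum>k\<le>D. of_nat k * (p k q * ?f q ^ (k - 1))) = 0" by (intro sum.neutral) auto
    then have "derivative p D ?f q = 0" by (simp add: derivative_def pointwise)
    then show False using der_q by simp
  qed
  have "form {0} (E - 1) s"
    unfolding s_def
  proof (rule form_sum)
    fix k assume k: "k \<in> {..D}"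
    show "form {0} (E - 1) ((\<lambda>_. p k a) * (?x ^ (E - k) *
      (\<Sum>j<k. ((\<lambda>_. ?\<eta>) * ?x) ^ (k - Suc j) * ?f ^ j)))"
    proof (cases "p k = 0 \<or> k = 0")
      case True
      then have "(\<lambda>_. p k a) * (?x ^ (E - k) *
        (\<Sum>j<k. ((\<lambda>_. ?\<eta>) * ?x) ^ (k - Suc j) * ?f ^ j)) = 0"
        by (auto simp: fun_eq_iff pointwise)
      then show ?thesis using form_zero by metis
    next
      case False
      then have kE: "k \<le> E" "0 < k" using deg(1) k by auto
      have "form {0} (k - 1) (\<Sum>j<k. ((\<lambda>_. ?\<eta>) * ?x) ^ (k - Suc j) * ?f ^ j)"
      proof (rule form_sum)
        fix j assume "j \<in> {..<k}"
        then have "k - 1 = 1 * (k - Suc j) + 1 * j" by auto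
        then show "form {0} (k - 1) (((\<lambda>_. ?\<eta>) * ?x) ^ (k - Suc j) * ?f ^ j)"
          using form_mult[OF form_power[OF form_scale[OF fx]] form_power[OF ff]] by metis
      qed
      then have "form {0} (1 * (E - k) + (k - 1)) (?x ^ (E - k) *
        (\<Sum>j<k. ((\<lambda>_. ?\<eta>) * ?x) ^ (k - Suc j) * ?f ^ j))"
        by (rule form_mult[OF form_power[OF fx]])
      moreover have degree: "1 * (E - k) + (k - 1) = E - 1" using kE by simp
      ultimately show ?thesis unfolding degree by (intro form_scale)
    qed
  qed
  moreover have "ideal_power C M 1 (E - 1 + 1) (s * (?f - (\<lambda>_. ?\<eta>) * ?x))"
    using B B_eq E by simp
  moreover have "s q \<noteq> 0" using s_q der_q by simp
  ultimately show ?thesis unfolding order_at_def by blast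
qed

text \<open>
  Locally at \<open>q\<close> the ideal of \<open>M\<close> is therefore the full ideal of the point \<open>q\<close>.
\<close>

lemma form_unramified:
  assumes "form {0} d f" and q: "q \<in> fiber"
  shows "order_at q M 1 d (f - (\<lambda>_. f q) * dot c0 ^ d)"
  using assms(1)
proof (induction rule: form.induct)
  case (form_add d f g)
  have "(f + g) - (\<lambda>_. (f + g) q) * dot c0 ^ d = (f - (\<lambda>_. f q) * dot c0 ^ d) + (g - (\<lambda>_. g q) * dot c0 ^ d)"
    by (auto simp: fun_eq_iff pointwise algebra_simps)
  then show ?case using order_at_add[OF form_add.IH] by metis
next
  case (form_dot c d f)
  have "order_at q M 1 1 (\<Sum>i\<in>UNIV. (\<lambda>_. c $ i) * (dot (axis i 1) - (\<lambda>_. q $ i) * dot c0))"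
    by (intro order_at_sum order_at_scale coordinate_unramified q)
  moreover have "form {0} d ((\<lambda>_. f q) * dot c0 ^ d)"
    using form_scale[OF form_power[OF form_linear, of c0 "{0}" d]] by simp
  ultimately have "order_at q M 1 (1 + d) (((\<lambda>_. f q) * dot c0 ^ d) *
      (\<Sum>i\<in>UNIV. (\<lambda>_. c $ i) * (dot (axis i 1) - (\<lambda>_. q $ i) * dot c0)))"
    by (rule order_at_mult_form)
  moreover have "order_at q M 1 (d + 1) (dot c * (f - (\<lambda>_. f q) * dot c0 ^ d))"
    by (intro order_at_mult_form form_dot.IH form_linear) simp
  ultimately have "order_at q M 1 (Suc d) (dot c * (f - (\<lambda>_. f q) * dot c0 ^ d) + ((\<lambda>_. f q) * dot c0 ^ d) *
      (\<Sum>i\<in>UNIV. (\<lambda>_. c $ i) * (dot (axis i 1) - (\<lambda>_. q $ i) * dot c0)))"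
    using order_at_add by simp
  then show ?case
  proof (rule order_at_cong)
    fix x
    have "(\<Sum>i\<in>UNIV. (\<lambda>_. c $ i) * (dot (axis i 1) - (\<lambda>_. q $ i) * dot c0)) x = dot c x - dot c q * dot c0 x"
      by (simp add: pointwise dot_def[of c] right_diff_distrib sum_subtractf sum_distrib_right mult.assoc)
    then show "(dot c * (f - (\<lambda>_. f q) * dot c0 ^ d) + ((\<lambda>_. f q) * dot c0 ^ d) *
      (\<Sum>i\<in>UNIV. (\<lambda>_. c $ i) * (dot (axis i 1) - (\<lambda>_. q $ i) * dot c0))) x =
      (dot c * f - (\<lambda>_. (dot c * f) q) * dot c0 ^ Suc d) x"
      by (simp only: plus_fun_apply times_fun_apply minus_apply power_fun_apply) (simp add: algebra_simps)
  qed
qed (auto intro!: order_at_zero simp: pointwise)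

lemma order_one_at:
  assumes "form {0} d f" "q \<in> fiber" "f q = 0"
  shows "order_at q M 1 d f"
  using form_unramified[OF assms(1,2)] by (rule order_at_cong) (simp add: pointwise assms(3))

text \<open>
  A form in the ideal of \<open>M\<close> is a combination \<open>\<Sum> dot c * t\<close> with \<open>c\<close> in the annihilator of \<open>M\<close>. Replacing
  each \<open>t\<close> by the multiple of \<open>s\<close> with the same value at \<open>q\<close> costs an error of second order.
\<close>

lemma linear_part:
  assumes h: "ideal_power C M 1 (n + 1) h" and s: "form {0} n s" "s q \<noteq> 0" and q: "q \<in> fiber"
  shows "\<exists>l\<in>annihilator M. order_at q M 2 (n + 1) (h - dot l * s)"
  using h
proof (induction rule: ideal_power.induct)
  case (ideal_power_zero h)
  then show ?case by (intro bexI[of _ 0] order_at_zero) (auto simp: pointwise)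
next
  case (ideal_power_step h g m t f)
  obtain l where l: "l \<in> annihilator M" "order_at q M 2 (n + 1) (h - dot l * s)"
    using ideal_power_step.IH by blast
  obtain c where c: "c \<in> annihilator M" "g = dot c" using form_degree_1[OF ideal_power_step.hyps(2)] .
  define \<kappa> where "\<kappa> = t q / s q"
  have t: "form {0} n t" using ideal_power_step.hyps(3,4) by simp
  have "order_at q M 1 n (t - (\<lambda>_. \<kappa>) * s)"
    by (intro order_one_at form_diff t form_scale s q) (simp add: pointwise \<kappa>_def s)
  moreover have "order_at q M 1 1 (dot c)"
    by (intro order_at_ideal_power form_imp_ideal_power form_linear c) simp
  ultimately have "order_at q M 2 (n + 1) (dot c * (t - (\<lambda>_. \<kappa>) * s))"
    using order_at_times[of q M 1 1 "dot c" 1 n] by (simp add: numeral_2_eq_2)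
  from order_at_add[OF this l(2)]
  have "order_at q M 2 (n + 1) (f - dot (\<kappa> *s c + l) * s)"
    by (rule order_at_cong) (simp add: ideal_power_step.hyps(5) c(2) pointwise algebra_simps)
  moreover have "\<kappa> *s c + l \<in> annihilator M" using c l by simp
  ultimately show ?case by blast
qed

lemma tangent_form:
  assumes "dot y q = 0" and q: "q \<in> fiber"
  shows "\<exists>l\<in>annihilator M. order_at q M 2 1 (dot (y - l))"
proof -
  have "order_at q M 1 1 (dot y)" using assms by (intro order_one_at form_linear) auto
  then obtain n s where s: "form {0} n s" "s q \<noteq> 0" "ideal_power C M 1 (n + 1) (s * dot y)"
    unfolding order_at_def by blast
  obtain l where l: "l \<in> annihilator M" "order_at q M 2 (n + 1) (s * dot y - dot l * s)"
    using linear_part[OF s(3,1,2) q] by blast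
  from l(2) have "order_at q M 2 (n + 1) (s * dot (y - l))"
    by (rule order_at_cong) (simp add: pointwise algebra_simps)
  then show ?thesis using order_at_cancel s l(1) by blast
qed

text \<open>
  Each coordinate of a point of the fibre is a root of one polynomial, which is nonzero because it has a
  simple root.
\<close>

lemma finite_fiber: "finite fiber"
proof (cases "fiber = {}")
  case False
  then obtain q0 where q0: "q0 \<in> fiber" by blast
  have "finite ((\<lambda>q. q $ i) ` fiber)" for i
  proof -
    let ?f = "dot (axis i 1) :: 'k ^ 'n \<Rightarrow> 'k"
    obtain E D p where rel: "algebraic_relation W 1 ?f E D p"
      and der: "\<forall>w\<in>W. a + w \<in> C \<longrightarrow> derivative p D ?f (a + w) \<noteq> 0"
      using unramified unfolding unramified_point_def by blast
    have pq: "p k q = p k a" if "k \<le> D" "q \<in> fiber" for k q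
      using fiberD(4)[OF that(2), of "E - k" "p k"] rel that(1)
      by (cases "p k = 0") (auto simp: zero_fun_apply algebraic_relation_def)
    define P where "P = (\<Sum>k\<le>D. monom (p k a) k)"
    have coeff: "coeff P k = (if k \<le> D then p k a else 0)" for k
      by (simp add: P_def coeff_sum)
    have "derivative p D ?f q0 \<noteq> 0" using der q0 by (auto simp: fiber_def)
    then have "(\<Sum>k\<le>D. of_nat k * (p k q0 * ?f q0 ^ (k - 1))) \<noteq> 0"
      by (simp add: derivative_def pointwise)
    then obtain k where "k \<le> D" "p k q0 \<noteq> 0"
      using sum.not_neutral_contains_not_neutral[of "\<lambda>k. of_nat k * (p k q0 * ?f q0 ^ (k - 1))" "{..D}"] by auto
    then have "coeff P k \<noteq> 0" using pq q0 coeff by simp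
    then have "P \<noteq> 0" by auto
    moreover have "poly P (q $ i) = 0" if "q \<in> fiber" for q
    proof -
      have "poly P (q $ i) = (\<Sum>k\<le>D. p k q * ?f q ^ k)"
        using pq that by (simp add: P_def poly_sum poly_monom)
      also have "\<dots> = 0" using rel fiberD(1)[OF that] by (auto simp: algebraic_relation_def)
      finally show ?thesis .
    qed
    ultimately show ?thesis
      by (intro finite_subset[OF _ poly_roots_finite[of P]]) auto
  qed
  then have "finite (Pi\<^sub>E UNIV (\<lambda>i. (\<lambda>q. q $ i) ` fiber))" by (intro finite_PiE) auto
  moreover have "vec_nth ` fiber \<subseteq> Pi\<^sub>E UNIV (\<lambda>i. (\<lambda>q. q $ i) ` fiber)" by auto
  ultimately have "finite (vec_nth ` fiber)" by (rule finite_subset[rotated])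
  then show ?thesis by (rule finite_imageD) (simp add: inj_on_def vec_nth_inject)
qed simp

lemma normalize:
  assumes q: "q \<in> C" "q \<noteq> 0" "q \<in> M"
  obtains t where "t \<noteq> 0" "(1 / t) *s q \<in> fiber"
proof -
  obtain t where t: "q - t *s a \<in> W" using q(3) mem_M_iff by blast
  have "t \<noteq> 0"
  proof
    assume "t = 0"
    then have "q \<in> W" using t by simp
    then show False using q disjoint by blast
  qed
  moreover have "(1 / t) *s (q - t *s a) \<in> W" using t subspace vec.subspace_scale by blast
  moreover have "(1 / t) *s q = a + (1 / t) *s (q - t *s a)"
    using \<open>t \<noteq> 0\<close> by (simp add: vec.scale_right_diff_distrib)
  ultimately show thesis using that scale[OF q(1)] unfolding fiber_def by blast
qed

text \<open>
  The form \<open>dot c0\<close> is transcendental over the forms vanishing on \<open>M\<close>, even after multiplication by a nonzero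
  one of them. By dominance the relation would hold on the whole space; there it can be restricted to a line
  in the direction of \<open>a\<close>, on which the coefficients are constant and \<open>dot c0\<close> takes all values.
\<close>

lemma independent_of_center:
  assumes \<alpha>: "form M d \<alpha>" "\<alpha> \<noteq> 0" and rel: "algebraic_relation M (Suc d) f E D p"
    and f: "\<And>x. x \<in> C \<Longrightarrow> f x = \<alpha> x * dot c0 x"
  shows False
proof -
  have deg: "Suc d * k \<le> E \<and> form M (E - Suc d * k) (p k)" if "k \<le> D" "p k \<noteq> 0" for k
    using rel that by (auto simp: algebraic_relation_def)
  obtain k where k: "k \<le> D" "p k \<noteq> 0" using rel by (auto simp: algebraic_relation_def)
  let ?g = "\<alpha> * dot c0"
  have fg: "form W (Suc d) ?g"
    using form_mult[OF form_antimono[OF \<alpha>(1) W_subset_M] form_linear[OF c0(1)]] by simp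
  have "form W E (\<Sum>k\<le>D. p k * ?g ^ k)"
  proof (rule form_sum)
    fix k assume "k \<in> {..D}"
    then show "form W E (p k * ?g ^ k)"
      using deg[of k] form_mult[OF form_antimono[OF _ W_subset_M] form_power[OF fg, of k], of "E - Suc d * k" "p k"]
      by (cases "p k = 0") (auto simp: form_zero)
  qed
  moreover have "(\<Sum>k\<le>D. p k * ?g ^ k) x = 0" if "x \<in> C" for x
    using rel f that by (simp add: algebraic_relation_def pointwise)
  ultimately have zero: "(\<Sum>k\<le>D. p k * ?g ^ k) = 0" using dominant by blast
  have "p k * \<alpha> ^ k \<noteq> 0"
  proof -
    have "\<alpha> ^ k \<noteq> 0" using \<alpha>(2) by (auto simp: fun_eq_iff pointwise)
    then show ?thesis using form_no_zero_divisors[OF _ form_power[OF \<alpha>(1)]] deg[OF k] k(2) by blast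
  qed
  then obtain v where v: "p k v * \<alpha> v ^ k \<noteq> 0" by (auto simp: fun_eq_iff pointwise)
  define P where "P = (\<Sum>k\<le>D. monom (p k v * \<alpha> v ^ k) k)"
  have "poly P z = 0" for z
  proof -
    \<comment> \<open>The point of the line through v at which the form dot c0 takes the value z.\<close>
    let ?u = "v + (z - dot c0 v) *s a"
    have inv: "g ?u = g v" if "form M e g" for e g
      using form_invariant[OF that vec.subspace_scale[OF M_subspace a_mem_M]] .
    have pu: "p j ?u = p j v" if "j \<le> D" for j
      using inv deg[OF that] by (cases "p j = 0") (auto simp: zero_fun_apply)
    have "poly P z = (\<Sum>j\<le>D. p j ?u * (\<alpha> ?u * dot c0 ?u) ^ j)"
      using pu inv[OF \<alpha>(1)] c0(2)
      by (simp add: P_def poly_sum poly_monom power_mult_distrib mult.assoc)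
    also have "\<dots> = (\<Sum>k\<le>D. p k * ?g ^ k) ?u" by (simp only: pointwise)
    finally show ?thesis using zero by (simp add: zero_fun_apply)
  qed
  then have "P = 0" using poly_all_0_iff_0 by blast
  moreover have "coeff P k = p k v * \<alpha> v ^ k" using k(1) by (simp add: P_def coeff_sum)
  ultimately show False using v by simp
qed

text \<open>
  Let \<open>y\<close> be a linear form that vanishes
  on \<open>C \<inter> M\<close> but not on \<open>M\<close>. At each point \<open>q\<close> of the fibre it agrees to second order with a linear form
  \<open>l q\<close> vanishing on \<open>M\<close>. The product \<open>g\<close> of the \<open>d\<close> linear forms \<open>y - l q\<close> thus vanishes to order
  \<open>d + 1\<close> at every point of the fibre, one more than its degree. By saturation both \<open>g\<close> and
  \<open>dot c0 * g\<close> are integral over the forms vanishing on \<open>M\<close>, and if \<open>g\<close> did not vanish on \<open>C\<close>, then \<open>dot c0\<close>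
  would be algebraic over them. So \<open>g\<close> vanishes on \<open>C\<close>, and by irreducibility \<open>C\<close> lies in one of the
  hyperplanes \<open>y = l q\<close>.
\<close>

lemma section_spans:
  assumes nondegenerate: "\<And>c. c \<noteq> 0 \<Longrightarrow> \<exists>x\<in>C. dot c x \<noteq> 0"
  shows "vec.span (C \<inter> M) = M"
proof (rule ccontr)
  assume "vec.span (C \<inter> M) \<noteq> M"
  moreover have "vec.span (C \<inter> M) \<subseteq> M" using M_subspace by (intro vec.span_minimal) auto
  ultimately obtain v where v: "v \<in> M" "v \<notin> vec.span (C \<inter> M)" by blast
  obtain y where y: "y \<in> annihilator (vec.span (C \<inter> M))" "dot y v = 1"
    using separating_functional[OF vec.subspace_span v(2)] .
  have y_fiber: "dot y q = 0" if "q \<in> fiber" for q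
    using annihilatorD[OF y(1)] vec.span_base fiberD(1,2)[OF that] by blast
  have "\<forall>q\<in>fiber. \<exists>l. l \<in> annihilator M \<and> order_at q M 2 1 (dot (y - l))"
    using tangent_form y_fiber by blast
  then obtain l where l: "\<And>q. q \<in> fiber \<Longrightarrow> l q \<in> annihilator M"
      "\<And>q. q \<in> fiber \<Longrightarrow> order_at q M 2 1 (dot (y - l q))"
    by metis
  define g where "g = (\<Prod>q\<in>fiber. dot (y - l q))"
  define d where "d = card fiber"
  have lin: "form {0} 1 (dot (y - l q))" for q by (intro form_linear) simp
  have fg: "form {0} d g"
    using form_prod[OF finite_fiber, of "{0}" "\<lambda>_. 1" "\<lambda>q. dot (y - l q)"] lin
    by (simp add: g_def d_def)
  have order_g: "order_at q M (d + 1) d g" if q: "q \<in> fiber" for q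
  proof -
    have d: "d = Suc (card (fiber - {q}))" unfolding d_def by (rule card.remove[OF finite_fiber q])
    have "order_at q M 1 1 (dot (y - l q'))" if "q' \<in> fiber" for q'
      using that q annihilatorD[OF l(1)[OF that] fiberD(2)[OF q]] y_fiber[OF q]
      by (intro order_one_at lin) simp_all
    then have "order_at q M (card (fiber - {q})) (card (fiber - {q})) (\<Prod>q'\<in>fiber - {q}. dot (y - l q'))"
      using order_at_prod[of "fiber - {q}" q M "\<lambda>_. 1" "\<lambda>_. 1"] finite_fiber by simp
    from order_at_times[OF l(2)[OF q] this] show ?thesis
      unfolding d g_def prod.remove[OF finite_fiber q] by simp
  qed
  have "\<exists>n s. form {0} n s \<and> s q \<noteq> 0 \<and> ideal_power C M (d + 1) (n + d) (s * g)"
    if q: "q \<in> C" "q \<noteq> 0" "q \<in> M" for q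
  proof -
    obtain t where t: "t \<noteq> 0" "(1 / t) *s q \<in> fiber" using normalize[OF q] .
    obtain n s where s: "form {0} n s" "s ((1 / t) *s q) \<noteq> 0" "ideal_power C M (d + 1) (n + d) (s * g)"
      using order_g[OF t(2)] unfolding order_at_def by blast
    then have "s q \<noteq> 0" using form_homogeneous[OF s(1), of "1 / t" q] by auto
    then show ?thesis using s by blast
  qed
  from saturation[OF M_subspace fg this]
  obtain N where N: "\<And>n f. N \<le> n \<Longrightarrow> form {0} n f \<Longrightarrow> ideal_power C M (d + 1) (n + d) (f * g)"
    by blast
  have acts_g: "acts M N d g"
    unfolding acts_def using fg N ideal_power_lower by (metis le_add1 order_refl)
  have acts_xg: "acts M N (d + 1) (dot c0 * g)"
    unfolding acts_def
  proof (intro conjI allI impI)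
    have fx: "form {0} 1 (dot c0)" by (intro form_linear) simp
    show "form {0} (d + 1) (dot c0 * g)" using form_mult[OF fx fg] by simp
    fix s :: "'k ^ 'n \<Rightarrow> 'k" assume s: "form {0} N s"
    have "ideal_power C M (d + 1) (N + 1 + d) (s * dot c0 * g)"
      using N[OF _ form_mult[OF s fx]] by simp
    then show "ideal_power C M (d + 1) (N + (d + 1)) (s * (dot c0 * g))" by (simp add: mult.assoc add_ac)
  qed
  have "\<not> (\<exists>x\<in>C. g x \<noteq> 0)"
  proof
    assume "\<exists>x\<in>C. g x \<noteq> 0"
    from norm_exists[OF acts_g this] obtain d' \<alpha> e' r where
      \<alpha>: "form M d' \<alpha>" "\<alpha> \<noteq> 0" and r: "acts M N e' r" "r \<noteq> 0 \<longrightarrow> d' = d + e'"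
        "\<forall>x\<in>C. \<alpha> x = g x * r x" .
    obtain x where "x \<in> C" "\<alpha> x \<noteq> 0" using dominant[OF form_antimono[OF \<alpha>(1) W_subset_M] \<alpha>(2)] by blast
    then have "r \<noteq> 0" using r(3) by (auto simp: zero_fun_apply)
    then have d': "d' = d + e'" using r(2) by blast
    have "acts M N (Suc d') (dot c0 * g * r)" using acts_mult[OF acts_xg r(1)] d' by simp
    from acting_imp_relation[OF this] obtain E D p where
      "algebraic_relation M (Suc d') (dot c0 * g * r) E D p" .
    then show False
      by (rule independent_of_center[OF \<alpha>]) (simp add: r(3) pointwise mult_ac)
  qed
  then obtain q where q: "q \<in> fiber" "\<not> (\<exists>x\<in>C. dot (y - l q) x \<noteq> 0)"
    using prod_nonvanishing[OF finite_fiber, of "\<lambda>_. 1" "\<lambda>q. dot (y - l q)"] lin unfolding g_def by blast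
  then have "y - l q = 0" using nondegenerate by blast
  then have "dot y v = 0" using annihilatorD[OF l(1)[OF q(1)] v(1)] by simp
  then show False using y(2) by simp
qed

end

section \<open>Affine cones over projective varieties\<close>

lemma eval_mpoly_superset:
  assumes "finite A" "Poly_Mapping.keys f \<subseteq> A"
  shows "eval_mpoly f x = (\<Sum>a\<in>A. Poly_Mapping.lookup f a * (\<Prod>i\<in>UNIV. x $ i ^ Poly_Mapping.lookup a i))"
  unfolding eval_mpoly_def using assms by (intro sum.mono_neutral_left) (auto simp: in_keys_iff)

lemma eval_mpoly_add: "eval_mpoly (f + g) x = eval_mpoly f x + eval_mpoly g x"
  using eval_mpoly_superset[of "Poly_Mapping.keys f \<union> Poly_Mapping.keys g" f x]
    eval_mpoly_superset[of "Poly_Mapping.keys f \<union> Poly_Mapping.keys g" g x]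
    eval_mpoly_superset[of "Poly_Mapping.keys f \<union> Poly_Mapping.keys g" "f + g" x] Poly_Mapping.keys_add[of f g]
  by (simp add: lookup_add algebra_simps sum.distrib)

lemma eval_mpoly_sum: "eval_mpoly (sum f A) x = (\<Sum>i\<in>A. eval_mpoly (f i) x)"
  by (induction A rule: infinite_finite_induct) (simp_all add: eval_mpoly_add, simp_all add: eval_mpoly_def)

lemma eval_mpoly_single:
  "eval_mpoly (Poly_Mapping.single a c) x = c * (\<Prod>i\<in>UNIV. x $ i ^ Poly_Mapping.lookup a i)"
  by (simp add: eval_mpoly_def)

definition homogeneous_of_degree :: "nat \<Rightarrow> ('k :: field, 'n :: finite) mpoly \<Rightarrow> bool" where
  "homogeneous_of_degree d f \<longleftrightarrow> (\<forall>a\<in>Poly_Mapping.keys f. (\<Sum>i\<in>UNIV. Poly_Mapping.lookup a i) = d)"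

lemma homogeneous_iff: "homogeneous f \<longleftrightarrow> (\<exists>d. homogeneous_of_degree d f)"
  by (simp add: homogeneous_def homogeneous_of_degree_def)

lemma homogeneous_of_degree_add:
  "homogeneous_of_degree d f \<Longrightarrow> homogeneous_of_degree d g \<Longrightarrow> homogeneous_of_degree d (f + g)"
  using Poly_Mapping.keys_add[of f g] unfolding homogeneous_of_degree_def by blast

lemma homogeneous_of_degree_sum:
  "(\<And>i. i \<in> A \<Longrightarrow> homogeneous_of_degree d (f i)) \<Longrightarrow> homogeneous_of_degree d (sum f A)"
  by (induction A rule: infinite_finite_induct)
    (auto intro: homogeneous_of_degree_add simp: homogeneous_of_degree_def[of d 0])

lemma form_eval_mpoly:
  fixes f :: "('k :: field, 'n :: finite) mpoly"
  assumes "homogeneous_of_degree d f"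
  shows "form {0} d (eval_mpoly f)"
proof -
  have "form {0} d (\<Sum>a\<in>Poly_Mapping.keys f. (\<lambda>_. Poly_Mapping.lookup f a) *
      (\<Prod>i\<in>UNIV. dot (axis i 1) ^ Poly_Mapping.lookup a i))"
  proof (intro form_sum form_scale)
    fix a assume a: "a \<in> Poly_Mapping.keys f"
    have "form {0} (\<Sum>i\<in>UNIV. 1 * Poly_Mapping.lookup a i)
        (\<Prod>i\<in>UNIV. dot (axis i 1) ^ Poly_Mapping.lookup a i :: 'k ^ 'n \<Rightarrow> 'k)"
      by (intro form_prod form_power form_linear) auto
    moreover have "(\<Sum>i\<in>UNIV. 1 * Poly_Mapping.lookup a i) = d"
      using a assms by (simp add: homogeneous_of_degree_def)
    ultimately show "form {0} d (\<Prod>i\<in>UNIV. dot (axis i 1) ^ Poly_Mapping.lookup a i :: 'k ^ 'n \<Rightarrow> 'k)"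
      by metis
  qed
  moreover have "(\<Sum>a\<in>Poly_Mapping.keys f. (\<lambda>_. Poly_Mapping.lookup f a) *
      (\<Prod>i\<in>UNIV. dot (axis i 1) ^ Poly_Mapping.lookup a i)) = eval_mpoly f"
    by (rule ext) (simp add: eval_mpoly_def pointwise)
  ultimately show ?thesis by simp
qed

lemma form_imp_mpoly:
  fixes g :: "'k :: field ^ 'n :: finite \<Rightarrow> 'k"
  assumes "form U d g"
  shows "\<exists>f. homogeneous_of_degree d f \<and> eval_mpoly f = g"
  using assms
proof (induction rule: form.induct)
  case (form_zero d)
  show ?case
    by (intro exI[of _ 0] conjI ext) (auto simp: homogeneous_of_degree_def eval_mpoly_def zero_fun_apply)
next
  case (form_const c)
  show ?case
    by (intro exI[of _ "Poly_Mapping.single 0 c"] conjI ext)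
      (auto simp: homogeneous_of_degree_def eval_mpoly_single split: if_splits)
next
  case (form_add d f g)
  then obtain F G where "homogeneous_of_degree d F" "eval_mpoly F = f"
    "homogeneous_of_degree d G" "eval_mpoly G = g" by blast
  then show ?case
    by (intro exI[of _ "F + G"] conjI ext) (auto simp: eval_mpoly_add homogeneous_of_degree_add plus_fun_apply)
next
  case (form_dot c d f)
  then obtain F where F: "homogeneous_of_degree d F" "eval_mpoly F = f" by blast
  let ?e = "\<lambda>i :: 'n. Poly_Mapping.single i (1 :: nat)"
  define G where "G = (\<Sum>i\<in>UNIV. \<Sum>b\<in>Poly_Mapping.keys F. Poly_Mapping.single (b + ?e i) (c $ i * Poly_Mapping.lookup F b))"
  have "homogeneous_of_degree (Suc d) G"
    unfolding G_def
  proof (intro homogeneous_of_degree_sum)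
    fix i b assume "b \<in> Poly_Mapping.keys F"
    then have "(\<Sum>j\<in>UNIV. Poly_Mapping.lookup (b + ?e i) j) = Suc d"
      using F(1) by (simp add: homogeneous_of_degree_def lookup_add sum.distrib lookup_single when_def)
    then show "homogeneous_of_degree (Suc d) (Poly_Mapping.single (b + ?e i) (c $ i * Poly_Mapping.lookup F b))"
      by (simp add: homogeneous_of_degree_def)
  qed
  moreover have "eval_mpoly G = dot c * f"
  proof
    fix x :: "'k ^ 'n"
    have shift: "(\<Prod>j\<in>UNIV. x $ j ^ Poly_Mapping.lookup (b + ?e i) j) =
        x $ i * (\<Prod>j\<in>UNIV. x $ j ^ Poly_Mapping.lookup b j)" for b i
    proof -
      have "(\<Prod>j\<in>UNIV. x $ j ^ Poly_Mapping.lookup (?e i) j) = (\<Prod>j\<in>UNIV. if j = i then x $ j else 1)"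
        by (intro prod.cong) (auto simp: lookup_single when_def)
      then show ?thesis by (simp add: lookup_add power_add prod.distrib mult.commute)
    qed
    have "eval_mpoly G x = (\<Sum>i\<in>UNIV. \<Sum>b\<in>Poly_Mapping.keys F. (c $ i * x $ i) *
        (Poly_Mapping.lookup F b * (\<Prod>j\<in>UNIV. x $ j ^ Poly_Mapping.lookup b j)))"
      unfolding G_def eval_mpoly_sum eval_mpoly_single shift by (simp add: mult_ac)
    also have "\<dots> = dot c x * eval_mpoly F x"
      unfolding dot_def eval_mpoly_def by (rule sum_product[symmetric])
    finally show "eval_mpoly G x = (dot c * f) x" by (simp add: F(2) times_fun_apply)
  qed
  ultimately show ?case by blast
qed

lemma line_of_subspace: "vec.subspace (line_of p)" and line_of_dim: "vec.dim (line_of p) = 1"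
  using line_of[of p] by auto

lemma line_of_eq_span:
  assumes "v \<in> line_of p" "v \<noteq> 0" shows "line_of p = vec.span {v}"
proof -
  have "vec.dim (vec.span {v}) = 1"
    using vec.dim_span_eq_card_independent[of "{v}"] assms(2) by simp
  then show ?thesis
    using assms(1) line_of_dim[of p]
    by (intro vec.subspace_dim_equal[symmetric] vec.subspace_span line_of_subspace vec.span_minimal) auto
qed

lemma line_of_nonzero:
  fixes p :: "('k :: field, 'n :: finite) proj"
  obtains v where "v \<in> line_of p" "v \<noteq> 0"
proof (rule ccontr)
  assume "\<not> thesis"
  then have "line_of p \<subseteq> {0}" using that by blast
  then have "vec.dim (line_of p) \<le> vec.dim {0 :: 'k ^ 'n}" by (rule vec.dim_subset)
  then show False by (simp add: line_of_dim)
qed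

lemma point_exists:
  fixes v :: "'k :: field ^ 'n :: finite"
  assumes "v \<noteq> 0" obtains p where "line_of p = vec.span {v}"
proof
  have "vec.dim (vec.span {v}) = 1"
    using vec.dim_span_eq_card_independent[of "{v}"] assms by simp
  then show "line_of (Proj (vec.span {v})) = vec.span {v}"
    by (intro Proj_inverse) (simp add: vec.subspace_span)
qed

lemma line_of_unique: "v \<in> line_of p \<Longrightarrow> v \<in> line_of q \<Longrightarrow> v \<noteq> 0 \<Longrightarrow> p = q"
  using line_of_eq_span line_of_inject by metis

text \<open>
  The origin is adjoined so that the cone over the empty set is a cone, too.
\<close>

definition affine_cone :: "('k :: field, 'n :: finite) proj set \<Rightarrow> ('k ^ 'n) set" where
  "affine_cone X = insert 0 (\<Union>p\<in>X. line_of p)"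

lemma line_subset_affine_cone: "p \<in> X \<Longrightarrow> line_of p \<subseteq> affine_cone X"
  by (auto simp: affine_cone_def)

lemma mem_affine_cone_iff: "v \<noteq> 0 \<Longrightarrow> v \<in> line_of p \<Longrightarrow> v \<in> affine_cone X \<longleftrightarrow> p \<in> X"
  unfolding affine_cone_def using line_of_unique by blast

lemma affine_cone_mono: "X \<subseteq> Y \<Longrightarrow> affine_cone X \<subseteq> affine_cone Y"
  by (auto simp: affine_cone_def)

lemma form_vanishes_on_line:
  assumes "form U d f" "v \<in> line_of p" "v \<noteq> 0" "f v = 0" "x \<in> line_of p"
  shows "f x = 0"
proof -
  obtain t where "x = t *s v" using assms(5) line_of_eq_span[OF assms(2,3)] vec.span_singleton by blast
  then show ?thesis using form_homogeneous[OF assms(1)] assms(4) by simp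
qed

lemma zariski_closed_form_section:
  assumes "zariski_closed X" "form {0} d f"
  shows "zariski_closed {p \<in> X. \<forall>x\<in>line_of p. f x = 0}"
proof -
  obtain F where F: "\<forall>f\<in>F. homogeneous f" "X = zero_locus F" using assms(1) by (auto simp: zariski_closed_def)
  obtain g where g: "homogeneous_of_degree d g" "eval_mpoly g = f" using form_imp_mpoly[OF assms(2)] by blast
  show ?thesis
    unfolding zariski_closed_def
    by (intro exI[of _ "insert g F"]) (use F g homogeneous_iff in \<open>auto simp: zero_locus_def\<close>)
qed

text \<open>
  If the product of two forms vanishes on \<open>X\<close>, then \<open>X\<close> is the union of the closed subsets where one of them
  vanishes, so it equals one of these subsets.
\<close>

lemma irreducible_cone_affine_cone:
  fixes X :: "('k :: {alg_closed_field, field_char_0}, 'n :: finite) proj set"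
  assumes X: "integral_subvariety X"
  shows "irreducible_cone (affine_cone X)"
proof
  have closed: "zariski_closed X" and ne: "X \<noteq> {}"
    and irr: "\<And>A B. zariski_closed A \<Longrightarrow> zariski_closed B \<Longrightarrow> X = A \<union> B \<Longrightarrow> X = A \<or> X = B"
    using X by (auto simp: integral_subvariety_def)
  show "0 \<in> affine_cone X" by (simp add: affine_cone_def)
  show "c *s x \<in> affine_cone X" if "x \<in> affine_cone X" for c x
    using that vec.subspace_scale[OF line_of_subspace] by (auto simp: affine_cone_def)
  obtain p where p: "p \<in> X" using ne by blast
  obtain v where "v \<in> line_of p" "v \<noteq> 0" using line_of_nonzero .
  then show "\<exists>x\<in>affine_cone X. x \<noteq> 0" using p by (auto simp: affine_cone_def)
  show "\<exists>d f. form {0} d f \<and> (\<forall>x\<in>affine_cone X. f x = 0) \<and> f v \<noteq> 0" if v: "v \<notin> affine_cone X" for v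
  proof -
    obtain F where F: "\<forall>f\<in>F. homogeneous f" "X = zero_locus F" using closed by (auto simp: zariski_closed_def)
    have v0: "v \<noteq> 0" using v by (auto simp: affine_cone_def)
    obtain p where p: "line_of p = vec.span {v}" using point_exists[OF v0] .
    then have vp: "v \<in> line_of p" by (simp add: vec.span_base)
    then have "p \<notin> X" using v line_subset_affine_cone by blast
    then obtain f x where f: "f \<in> F" "x \<in> line_of p" "eval_mpoly f x \<noteq> 0"
      using F(2) by (auto simp: zero_locus_def)
    obtain d where d: "homogeneous_of_degree d f" using F(1) f(1) homogeneous_iff by blast
    note form = form_eval_mpoly[OF d]
    have "eval_mpoly f v \<noteq> 0" using form_vanishes_on_line[OF form vp v0 _ f(2)] f(3) by blast
    moreover have "eval_mpoly f x = 0" if x: "x \<in> affine_cone X" for x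
    proof -
      obtain q where q: "q \<in> X" using ne by blast
      obtain r where "r \<in> X" "x \<in> line_of r"
      proof (cases "x = 0")
        case True
        then show ?thesis using that q vec.subspace_0[OF line_of_subspace] by blast
      next
        case False
        then show ?thesis using that x by (auto simp: affine_cone_def)
      qed
      then show ?thesis using F(2) f(1) by (auto simp: zero_locus_def)
    qed
    ultimately show ?thesis using form by blast
  qed
  show "(\<forall>x\<in>affine_cone X. f x = 0) \<or> (\<forall>x\<in>affine_cone X. g x = 0)"
    if f: "form {0} d f" and g: "form {0} e g" and fg: "\<forall>x\<in>affine_cone X. f x * g x = 0" for d e f g
  proof -
    let ?V = "\<lambda>f. {p \<in> X. \<forall>x\<in>line_of p. f x = 0}"
    have "p \<in> ?V f \<union> ?V g" if p: "p \<in> X" for p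
    proof -
      obtain v where v: "v \<in> line_of p" "v \<noteq> 0" using line_of_nonzero .
      then have "f v = 0 \<or> g v = 0" using fg line_subset_affine_cone[OF p] by auto
      then show ?thesis
        using form_vanishes_on_line[OF f v] form_vanishes_on_line[OF g v] p by blast
    qed
    then have "X = ?V f \<union> ?V g" by blast
    then have "X = ?V f \<or> X = ?V g"
      using irr zariski_closed_form_section[OF closed] f g by blast
    moreover have "\<forall>x\<in>affine_cone X. h x = 0" if h: "X = ?V h" for h
    proof -
      have zero: "h x = 0" if "q \<in> X" "x \<in> line_of q" for q x
        using that h by blast
      obtain q where q: "q \<in> X" using ne by blast
      have "h 0 = 0" using zero[OF q] vec.subspace_0[OF line_of_subspace] by blast
      then show ?thesis using zero by (auto simp: affine_cone_def)
    qed
    ultimately show ?thesis by blast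
  qed
qed

section \<open>Centres and dimension\<close>

text \<open>
  If a nonzero form on the target of the projection from \<open>U\<close> vanishes on \<open>D\<close>, then the projection misses a
  point, and \<open>U\<close> can be enlarged by that point.
\<close>

lemma larger_center:
  fixes U D :: "('k :: field_char_0 ^ 'n :: finite) set"
  assumes U: "vec.subspace U" "U \<noteq> UNIV" and D: "D \<inter> U \<subseteq> {0}"
    and \<alpha>: "form U d \<alpha>" "\<alpha> \<noteq> 0" "\<And>x. x \<in> D \<Longrightarrow> \<alpha> x = 0"
  obtains U' where "vec.subspace U'" "U \<subseteq> U'" "vec.dim U' = vec.dim U + 1" "D \<inter> U' \<subseteq> {0}"
proof -
  obtain v where "v \<notin> U" using U(2) by blast
  then obtain c where c: "c \<in> annihilator U" "dot c v = 1" using separating_functional[OF U(1)] by blast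
  then have "dot c \<noteq> 0" by (auto simp: zero_fun_apply)
  then have "\<alpha> * dot c \<noteq> 0" using form_no_zero_divisors[OF \<alpha>(1) form_linear[OF c(1)]] \<alpha>(2) by blast
  then obtain a where a: "\<alpha> a \<noteq> 0" "dot c a \<noteq> 0" by (auto simp: fun_eq_iff pointwise)
  then have "a \<notin> U" using c(1) annihilatorD by blast
  have spanU: "vec.span U = U" using U(1) by (simp add: vec.span_eq_iff)
  let ?U = "vec.span (insert a U)"
  have "x = 0" if x: "x \<in> D" "x \<in> ?U" for x
  proof -
    obtain t where t: "x - t *s a \<in> U" using x(2) unfolding vec.span_breakdown_eq spanU by blast
    have "\<alpha> x = \<alpha> (t *s a + (x - t *s a))" by simp
    also have "\<dots> = t ^ d * \<alpha> a" using form_invariant[OF \<alpha>(1) t] form_homogeneous[OF \<alpha>(1)] by metis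
    finally have "t ^ d = 0" using \<alpha>(3)[OF x(1)] a(1) by simp
    then have "t = 0" by simp
    then have "x \<in> U" using t by simp
    then show ?thesis using x(1) D by blast
  qed
  then have "D \<inter> ?U \<subseteq> {0}" by blast
  moreover have "vec.dim ?U = vec.dim U + 1"
    using \<open>a \<notin> U\<close> by (simp add: vec.dim_insert vec.dim_span spanU)
  moreover have "U \<subseteq> ?U" using vec.span_superset by blast
  ultimately show thesis using that[OF vec.subspace_span] by simp
qed

text \<open>
  Induction along the chain. A form that vanishes on \<open>Z r\<close> but not on \<open>Z (r + 1)\<close> divides on \<open>Z (r + 1)\<close> a
  nonzero form on the target of the projection from \<open>U\<close>. This form vanishes on \<open>Z r\<close>, so that \<open>Z r\<close> misses
  a centre whose dimension is larger by one.
\<close>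

lemma chain_length_bound:
  fixes Z :: "nat \<Rightarrow> ('k :: {alg_closed_field, field_char_0}, 'n :: finite) proj set"
  assumes "\<forall>i\<le>r. integral_subvariety (Z i)" "\<forall>i<r. Z i \<subset> Z (Suc i)"
    and "vec.subspace U" "affine_cone (Z r) \<inter> U \<subseteq> {0}"
  shows "r + 1 + vec.dim U \<le> CARD('n)"
  using assms
proof (induction r arbitrary: U)
  case (0 U)
  interpret irreducible_cone "affine_cone (Z 0)" using 0 by (simp add: irreducible_cone_affine_cone)
  have "U \<noteq> UNIV" using nontrivial 0 by blast
  then have "vec.dim U < CARD('n)"
    using vec.dim_eq_full[of U] dim_subset_UNIV_cart_gen[of U] 0(3)
    by (simp add: vec.span_eq_iff[THEN iffD2] card_cart_basis vec.dimension_def le_less)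
  then show ?case by simp
next
  case (Suc r U)
  interpret small: irreducible_cone "affine_cone (Z r)" using Suc.prems by (simp add: irreducible_cone_affine_cone)
  interpret irreducible_cone "affine_cone (Z (Suc r))" using Suc.prems by (simp add: irreducible_cone_affine_cone)
  have sub: "affine_cone (Z r) \<subseteq> affine_cone (Z (Suc r))" using Suc.prems by (intro affine_cone_mono) auto
  obtain p where p: "p \<in> Z (Suc r)" "p \<notin> Z r" using psubset_imp_ex_mem[of "Z r" "Z (Suc r)"] Suc.prems(2) by auto
  obtain v where v: "v \<in> line_of p" "v \<noteq> 0" using line_of_nonzero .
  then have v_mem: "v \<in> affine_cone (Z (Suc r))" "v \<notin> affine_cone (Z r)" using p mem_affine_cone_iff by blast+
  obtain e f where f: "form {0} e f" "\<forall>x\<in>affine_cone (Z r). f x = 0" "f v \<noteq> 0"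
    using small.closed[OF v_mem(2)] by blast
  obtain N where "\<And>e f. form {0} e f \<Longrightarrow> acts U N e f"
    using all_forms_act[OF Suc.prems(3,4)] by blast
  then have acts: "acts U N e f" using f(1) by blast
  have nz: "\<exists>x\<in>affine_cone (Z (Suc r)). f x \<noteq> 0" using v_mem f(3) by blast
  from norm_exists[OF acts nz] obtain d \<alpha> e' g where \<alpha>: "form U d \<alpha>" "\<alpha> \<noteq> 0"
    and "acts U N e' g" "g \<noteq> 0 \<longrightarrow> d = e + e'" and eq: "\<forall>x\<in>affine_cone (Z (Suc r)). \<alpha> x = f x * g x" .
  have "\<alpha> x = 0" if "x \<in> affine_cone (Z r)" for x using that sub eq f(2) by auto
  moreover have "U \<noteq> UNIV" using Suc.prems(4) v_mem(1) v(2) by blast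
  moreover have "affine_cone (Z r) \<inter> U \<subseteq> {0}" using sub Suc.prems(4) by blast
  ultimately obtain U' where U': "vec.subspace U'" "vec.dim U' = vec.dim U + 1" "affine_cone (Z r) \<inter> U' \<subseteq> {0}"
    using larger_center[OF Suc.prems(3) _ _ \<alpha>] by metis
  have "r + 1 + vec.dim U' \<le> CARD('n)"
    using Suc.prems U' by (intro Suc.IH) auto
  then show ?case using U'(2) by simp
qed

lemma variety_dim_bound:
  fixes X :: "('k :: {alg_closed_field, field_char_0}, 'n :: finite) proj set"
  assumes "vec.subspace U" "affine_cone X \<inter> U \<subseteq> {0}"
  shows "variety_dim X \<le> enat (CARD('n) - 1 - vec.dim U)"
  unfolding variety_dim_def
proof (rule Sup_least)
  fix d assume "d \<in> {enat r | r. \<exists>Z :: nat \<Rightarrow> ('k, 'n) proj set.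
     (\<forall>i\<le>r. integral_subvariety (Z i) \<and> Z i \<subseteq> X) \<and> (\<forall>i<r. Z i \<subset> Z (Suc i))}"
  then obtain r Z where d: "d = enat r" and Z: "\<forall>i\<le>r. integral_subvariety (Z i) \<and> Z i \<subseteq> X"
    "\<forall>i<r. Z i \<subset> Z (Suc i)" by blast
  have "affine_cone (Z r) \<inter> U \<subseteq> {0}" using affine_cone_mono[of "Z r" X] Z(1) assms(2) by blast
  then have "r + 1 + vec.dim U \<le> CARD('n)"
    using Z assms(1) by (intro chain_length_bound[of r Z]) auto
  then show "d \<le> enat (CARD('n) - 1 - vec.dim U)" by (simp add: d)
qed

lemma maximal_center_exists:
  fixes X :: "('k :: {alg_closed_field, field_char_0}, 'n :: finite) proj set"
  assumes X: "integral_subvariety X" and W0: "vec.subspace W0" "affine_cone X \<inter> W0 \<subseteq> {0}"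
  obtains W where "W0 \<subseteq> W" "maximal_center (affine_cone X) W"
proof -
  interpret irreducible_cone "affine_cone X" by (rule irreducible_cone_affine_cone[OF X])
  let ?P = "\<lambda>W. vec.subspace W \<and> W0 \<subseteq> W \<and> affine_cone X \<inter> W \<subseteq> {0}"
  have "\<exists>W. ?P W \<and> (\<forall>W'. ?P W' \<longrightarrow> vec.dim W' \<le> vec.dim W)"
  proof (rule ex_has_greatest_nat[where k = W0])
    show "?P W0" using W0 by simp
    show "\<forall>W'. ?P W' \<longrightarrow> vec.dim W' < Suc CARD('n)"
      by (intro allI impI le_imp_less_Suc dim_subset_UNIV_cart_gen)
  qed
  then obtain W where W_max: "?P W \<and> (\<forall>W'. ?P W' \<longrightarrow> vec.dim W' \<le> vec.dim W)" by (rule exE)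
  note W = W_max[THEN conjunct1] and max = W_max[THEN conjunct2]
  have "\<exists>x\<in>affine_cone X. f x \<noteq> 0" if f: "form W d f" "f \<noteq> 0" for d f
  proof (rule ccontr)
    assume "\<not> ?thesis"
    then have zero: "\<And>x. x \<in> affine_cone X \<Longrightarrow> f x = 0" by blast
    have "W \<noteq> UNIV" using W nontrivial by blast
    then obtain W' where "vec.subspace W'" "W \<subseteq> W'" "vec.dim W' = vec.dim W + 1" "affine_cone X \<inter> W' \<subseteq> {0}"
      using larger_center[OF _ _ _ f zero] W by metis
    then show False using max[rule_format, of W'] W by force
  qed
  then have "maximal_center (affine_cone X) W"
    using W by unfold_locales auto
  with W show thesis by (intro that) auto
qed

section \<open>The bound on the rank\<close>

theorem proposition3:
  fixes X V :: "('k :: {alg_closed_field, field_char_0}, 'n :: finite) proj set"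
    and n m :: nat
  assumes "CARD('n) = n + 1"
    and "integral_subvariety X"
    and "nondegenerate X"
    and "variety_dim X = enat m"
    and "linear_subspace V" and "V \<noteq> {}"
    and "V \<inter> X = {}"
  shows "X_rank X V \<le> enat (n + 1 - m)"
proof -
  obtain W0 where W0: "vec.subspace W0" "V = {p. line_of p \<subseteq> W0}"
    using assms(5) by (auto simp: linear_subspace_def)
  have "x = 0" if x: "x \<in> affine_cone X" "x \<in> W0" for x
  proof (rule ccontr)
    assume "x \<noteq> 0"
    then obtain p where p: "p \<in> X" "x \<in> line_of p" using x(1) by (auto simp: affine_cone_def)
    then have "line_of p \<subseteq> W0"
      using line_of_eq_span[OF _ \<open>x \<noteq> 0\<close>] x(2) vec.span_minimal[OF _ W0(1), of "{x}"] by auto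
    then show False using p(1) W0(2) assms(7) by blast
  qed
  then have "affine_cone X \<inter> W0 \<subseteq> {0}" by blast
  from maximal_center_exists[OF assms(2) W0(1) this] obtain W where W: "W0 \<subseteq> W" "maximal_center (affine_cone X) W" .
  interpret maximal_center "affine_cone X" W by (rule W(2))
  obtain a where a: "a \<notin> W" "unramified_point a" using unramified_point_exists .
  obtain c0 where c0: "c0 \<in> annihilator W" "dot c0 a = 1" using separating_functional[OF subspace a(1)] .
  interpret unramified_section "affine_cone X" W a c0 by unfold_locales (use a c0 in auto)
  have nondegenerate: "\<exists>x\<in>affine_cone X. dot c x \<noteq> 0" if c: "c \<noteq> 0" for c
  proof (rule ccontr)
    assume "\<not> ?thesis"
    then have "X \<subseteq> {p. line_of p \<subseteq> {x. dot c x = 0}}" using line_subset_affine_cone by blast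
    moreover have "linear_subspace {p. line_of p \<subseteq> {x. dot c x = 0}}"
      unfolding linear_subspace_def by (intro exI[of _ "{x. dot c x = 0}"]) (simp add: vec.subspace_def)
    ultimately have "linear_span X \<subseteq> {p. line_of p \<subseteq> {x. dot c x = 0}}"
      unfolding linear_span_def by (rule hull_minimal)
    then have hyper: "line_of p \<subseteq> {x. dot c x = 0}" for p :: "('k, 'n) proj"
      using assms(3) by (auto simp: nondegenerate_def)
    obtain v where v: "dot c v \<noteq> 0" using c dot_eq_0_iff by blast
    then have "v \<noteq> 0" by auto
    from point_exists[OF this] obtain p :: "('k, 'n) proj" where "line_of p = vec.span {v}" .
    then show False using hyper[of p] v vec.span_base[of v "{v}"] by auto
  qed
  obtain B where B: "B \<subseteq> affine_cone X \<inter> M" "vec.independent B" "affine_cone X \<inter> M \<subseteq> vec.span B"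
    "card B = vec.dim (affine_cone X \<inter> M)"
    by (rule vec.basis_exists)
  have span_B: "M \<subseteq> vec.span B"
    using section_spans[OF nondegenerate] B(3) vec.span_minimal[OF B(3) vec.subspace_span] by simp
  have "vec.dim (affine_cone X \<inter> M) = vec.dim M"
    using section_spans[OF nondegenerate] vec.dim_span by metis
  also have "\<dots> = vec.dim W + 1"
    unfolding M_def using a(1) subspace by (simp add: vec.dim_span vec.dim_insert vec.span_eq_iff[THEN iffD2])
  finally have card_B: "card B = vec.dim W + 1" using B(4) by simp
  have "affine_cone X \<inter> M \<noteq> {}" using zero_mem M_subspace vec.subspace_0 by blast
  have dimW: "vec.dim W + 1 \<le> CARD('n)"
  proof -
    have "card B \<le> CARD('n)" using vec.independent_card_le_dim[of B UNIV] B(2) by (simp add: card_cart_basis)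
    then show ?thesis using card_B by simp
  qed
  have "enat m \<le> enat (n - vec.dim W)"
    using variety_dim_bound[OF subspace disjoint] assms(1,4) by simp
  then have bound: "card B \<le> n + 1 - m"
    using card_B dimW assms(1) by simp
  have finB: "finite B" using B(2) by (rule vec.finiteI_independent)
  have point: "\<exists>p\<in>X. line_of p = vec.span {b}" if b: "b \<in> B" for b
  proof -
    have "b \<noteq> 0" using b B(2) vec.dependent_zero by metis
    then obtain p where "p \<in> X" "b \<in> line_of p" using b B(1) by (auto simp: affine_cone_def)
    then show ?thesis using line_of_eq_span \<open>b \<noteq> 0\<close> by blast
  qed
  then obtain pt where pt: "\<And>b. b \<in> B \<Longrightarrow> pt b \<in> X" "\<And>b. b \<in> B \<Longrightarrow> line_of (pt b) = vec.span {b}"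
    by metis
  have "V \<subseteq> linear_span (pt ` B)"
    unfolding linear_span_def hull_def
  proof (intro Inter_greatest)
    fix T assume "T \<in> {T. linear_subspace T \<and> pt ` B \<subseteq> T}"
    then obtain U where U: "vec.subspace U" "T = {p. line_of p \<subseteq> U}" "pt ` B \<subseteq> T"
      by (auto simp: linear_subspace_def)
    have "b \<in> U" if "b \<in> B" for b
      using U(2,3) that pt(2)[OF that] vec.span_base[of b "{b}"] by blast
    then have "vec.span B \<subseteq> U" using U(1) by (intro vec.span_minimal) auto
    then have "W0 \<subseteq> U" using W(1) W_subset_M span_B by blast
    then show "V \<subseteq> T" using W0(2) U(2) by blast
  qed
  then have "X_rank X V \<le> enat (card (pt ` B))"
    unfolding X_rank_def using finB pt(1) by (intro INF_lower) auto
  also have "\<dots> \<le> enat (n + 1 - m)"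
    using card_image_le[OF finB, of pt] bound by simp
  finally show ?thesis .
qed

end
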